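(* Consider long-range first-passage percolation on $\mathbb{Z}^d$ (setting in the context) with a nonnegative non-increasing rate function $r(k)=k^{-d}L(k)$, $k\ge1$, where $L$ is slowly varying at infinity with $L(1)=1$ and $$\int_1^\infty\frac{L(x)}{x}\,dx<\infty,\qquad \int_1^\infty\frac{-\log L(x)}{x(\log x)^2}\,dx<\infty.$$ Then there are constants $0<c<C<\infty$ depending on $L$ such that $$\lim_{\|x\|_1\to\infty}\mathbb{P}\Big(c\le\frac{T(0,x)}{\log\|x\|_1}\le C\Big)=1.$$ Moreover, there is a constant $a>0$ such that $\mathbb{E}|\mathcal{B}_t|\ge e^{at}$ for all $t\ge0$.
   Context: Let $d\ge1$ and $\|x\|_1=\sum_i|x_i|$. Let $\mathcal{E}$ be the set of unordered pairs $e=\langle xy\rangle$ of distinct points of $\mathbb{Z}^d$, with length $\|e\|_1=\|x-y\|_1$. Let $(\omega_e)_{e\in\mathcal{E}}$ be i.i.d. mean-one exponential random variables and $W_e=\omega_e/r(\|e\|_1)$. For a finite path $\pi=\langle x_0\dots x_k\rangle$ ($x_i\ne x_{i-1}$), $W_\pi=\sum_iW_{\langle x_{i-1}x_i\rangle}$; $T(x,y)$ is the infimum of $W_\pi$ over finite paths from $x$ to $y$; $\mathcal{B}_t=\{x:T(0,x)\le t\}$. *)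

theory Defs
  imports "HOL-Probability.Probability"
begin

definition norm1 :: "int ^ 'd \<Rightarrow> real" where
  "norm1 x = (\<Sum>i\<in>UNIV. real_of_int \<bar>x $ i\<bar>)"

definition edges :: "(int ^ 'd) set set" where
  "edges = {e. \<exists>x y. x \<noteq> y \<and> e = {x, y}}"

definition rate :: "nat \<Rightarrow> (real \<Rightarrow> real) \<Rightarrow> real \<Rightarrow> real" where
  "rate d L k = k powr (- real d) * L k"

definition slowly_varying :: "(real \<Rightarrow> real) \<Rightarrow> bool" where
  "slowly_varying L \<longleftrightarrow> L \<in> borel_measurable borel \<and> (\<forall>x\<ge>1. L x > 0) \<and>
     (\<forall>lam>0. ((\<lambda>x. L (lam * x) / L x) \<longlongrightarrow> 1) at_top)"

definition edge_weight ::
  "(real \<Rightarrow> real) \<Rightarrow> ((int ^ 'd) set \<Rightarrow> 'a \<Rightarrow> real) \<Rightarrow> 'a \<Rightarrow> int ^ 'd \<Rightarrow> int ^ 'd \<Rightarrow> real" where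
  "edge_weight L \<omega> s x y = \<omega> {x, y} s / rate CARD('d) L (norm1 (x - y))"

definition is_path :: "(int ^ 'd) list \<Rightarrow> bool" where
  "is_path p \<longleftrightarrow> p \<noteq> [] \<and> (\<forall>i < length p - 1. p ! i \<noteq> p ! Suc i)"

definition path_weight ::
  "(real \<Rightarrow> real) \<Rightarrow> ((int ^ 'd) set \<Rightarrow> 'a \<Rightarrow> real) \<Rightarrow> 'a \<Rightarrow> (int ^ 'd) list \<Rightarrow> real" where
  "path_weight L \<omega> s p = (\<Sum>i < length p - 1. edge_weight L \<omega> s (p ! i) (p ! Suc i))"

definition passage_time ::
  "(real \<Rightarrow> real) \<Rightarrow> ((int ^ 'd) set \<Rightarrow> 'a \<Rightarrow> real) \<Rightarrow> 'a \<Rightarrow> int ^ 'd \<Rightarrow> int ^ 'd \<Rightarrow> real" where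
  "passage_time L \<omega> s x y =
     Inf {path_weight L \<omega> s p | p. is_path p \<and> hd p = x \<and> last p = y}"

definition fpp_ball ::
  "(real \<Rightarrow> real) \<Rightarrow> ((int ^ 'd) set \<Rightarrow> 'a \<Rightarrow> real) \<Rightarrow> 'a \<Rightarrow> real \<Rightarrow> (int ^ 'd) set" where
  "fpp_ball L \<omega> s t = {x. passage_time L \<omega> s 0 x \<le> t}"

end

(*
The rate enters only through its values at powers of two. On a set of ratios of positive measure
slow variation is uniform, so the two integral conditions turn into the convergence of the sums of
L(2^j) and of -log L(2^j) / j^2.

Lower bound. The expected number of cheap simple paths is at most exp(\<theta> t) times a Green's function
of the walk with step weights r / \<theta>. For large \<theta> this function is finite, and it decays like 1 / |x|
because a walk with k steps from 0 to x has a step of length at least |x| / k.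

Upper bound. Let \<Phi>(j) be the worst exponential moment of the passage time between two points of a
dyadic box of side 2^j, along paths inside the box. Joining disjoint sub-boxes of sides 2^i and 2^i'
around the end points by the cheapest crossing edge gives \<Phi>(j) <= 2 \<Phi>(i) \<Phi>(i') whenever
i + i' >= j + B(j), where B(j) is of order 1 + log(1 / L(2^j)). The set of scales where L is small may
be hit by every chain i = i' = j/2, so the split is chosen by averaging over i between one third and
two thirds; the losses then add up to a constant multiple of the sum of B(i) / i^2, and log \<Phi>(j) is
at most linear in j. Markov's inequality for the exponential moment gives the upper bound with
probability tending to one, and it also makes the expected ball contain at least half of a box of side
exp(a t).
*)
theory Submission
  imports Defs
begin

subsection \<open>Splitting scales\<close>

text \<open>Exponential moments, rather than tail probabilities, are carried through the scales
  because a joined path has three pieces that use disjoint edge sets, so the moment of their sum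
  factorises. The factor 2 is the moment of the minimum of N exponential variables. It is available
  with one and the same parameter at all large scales only if N times the rate at the diameter of
  the box stays above 1; this is what i + i' >= j + B(j) provides, and it dictates the size of B.
  The factor itself costs nothing: 2 \<Phi> is submultiplicative, so its logarithm only has to stay
  below a function that is superadditive along the chosen splits. Monotonicity of the rate is known
  at integers only and slow variation only pointwise, while the hypotheses integrate over real
  arguments; hence the detour through a set of good ratios. Since exp(a t) equals 1 at t = 0, the
  growth of the ball cannot be deduced from large boxes alone. Near t = 0 it comes from a single
  unit edge, whose rate is L(1) = 1.\<close>

lemma exists_scale_splitting:
  fixes B :: "nat \<Rightarrow> nat"
  assumes B1: "\<And>j. 1 \<le> B j"
    and summ: "summable (\<lambda>j. real (B j) / (real j)\<^sup>2)"
    and small: "eventually (\<lambda>j. 8 * B j \<le> j) sequentially"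
  shows "\<exists>(g::nat \<Rightarrow> real) j0 C. 0 < C \<and> (\<forall>j. g j \<le> C * (real j + 1)) \<and> (\<forall>j. 1 \<le> g j) \<and>
    (\<forall>j>j0. \<exists>i i'. i' \<le> i \<and> i < j \<and> j + B j \<le> i + i' \<and> g i + g i' \<le> g j)"
proof -
  obtain J where J: "\<And>j. J \<le> j \<Longrightarrow> 8 * B j \<le> j"
    using small unfolding eventually_sequentially by blast
  define t where "t i = real (B i) / (real i)\<^sup>2" for i
  have t0: "0 \<le> t i" for i unfolding t_def by simp
  have st: "summable t" using summ unfolding t_def .
  \<comment> \<open>The weight grows by at least 3/8 from \<open>3/4 * v\<close> to \<open>v\<close> at every \<open>i\<close> in \<open>{v/3..2*v/3}\<close>, which
    pays for the loss of a split at an averaged \<open>i\<close>.\<close>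
  define E where "E v = (\<Sum>i. t i * min (v / real i) 3)" for v :: real
  have sE: "summable (\<lambda>i. t i * min (v / real i) 3)" if "0 \<le> v" for v
  proof (rule summable_comparison_test'[where N=0 and g="\<lambda>i. t i * 3"])
    show "summable (\<lambda>i. t i * 3)" using st by (rule summable_mult2)
    show "norm (t i * min (v / real i) 3) \<le> t i * 3" for i
      using t0[of i] that by (simp add: abs_mult mult_left_mono)
  qed
  have E_mono: "E u \<le> E v" if "0 \<le> u" "u \<le> v" for u v
    unfolding E_def using that
    by (intro suminf_le sE mult_left_mono t0 min.mono divide_right_mono) auto
  have E_nonneg: "0 \<le> E v" if "0 \<le> v" for v
    unfolding E_def using that t0 by (intro suminf_nonneg sE) auto
  define S where "S = (\<Sum>i. t i * 3)"
  have E_le: "E v \<le> S" if "0 \<le> v" for v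
    unfolding E_def S_def using that
    by (intro suminf_le sE summable_mult2 st mult_left_mono t0) auto
  have E_gap: "(\<Sum>i\<in>I. t i * (3/8)) \<le> E v - E (3/4 * v)"
    if v: "0 < v" and "finite I" and Iv: "\<And>i. i \<in> I \<Longrightarrow> v \<le> 3 * real i \<and> 3 * real i \<le> 2 * v" for v I
  proof -
    let ?f = "\<lambda>i. t i * min (v / real i) 3 - t i * min (3/4 * v / real i) 3"
    have f0: "0 \<le> ?f i" for i
      using t0[of i] divide_right_mono[of "3/4 * v" v "real i"] \<open>0 < v\<close>
      by (simp add: mult_left_mono min.mono)
    have "t i * (3/8) \<le> ?f i" if i: "i \<in> I" for i
    proof -
      have ip: "0 < real i" using i Iv[OF i] v by linarith
      have 1: "v / real i \<le> 3" "3/2 \<le> v / real i"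
        using Iv[OF i] ip by (auto simp: field_simps)
      have "3/8 \<le> min (v / real i) 3 - min (3/4 * v / real i) 3"
      proof -
        have "3/4 * v / real i = 3/4 * (v / real i)" by simp
        then show ?thesis using 1 by linarith
      qed
      then have "t i * (3/8) \<le> t i * (min (v / real i) 3 - min (3/4 * v / real i) 3)"
        by (intro mult_left_mono t0)
      then show ?thesis by (simp add: right_diff_distrib)
    qed
    then have "(\<Sum>i\<in>I. t i * (3/8)) \<le> (\<Sum>i\<in>I. ?f i)" by (intro sum_mono)
    also have "\<dots> \<le> (\<Sum>i. ?f i)"
      using that f0 by (intro sum_le_suminf summable_diff sE) auto
    also have "\<dots> = E v - E (3/4 * v)"
      unfolding E_def using that by (intro suminf_diff[symmetric] sE) auto
    finally show ?thesis .
  qed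
  \<comment> \<open>\<open>E\<close> is bounded by \<open>S\<close>, so \<open>g\<close> stays
    linear in j plus its loss, yet its factor grows between \<open>3/4 * v\<close> and
    \<open>v\<close> by enough to pay for one split. The 11 only has to exceed (32/9) * (8/3), the
    constant that the averaging below produces.\<close>
  define g where "g j = exp (11 * E (real (j + B j))) * real (j + B j)" for j
  have g1: "1 \<le> g j" for j
  proof -
    have "1 * 1 \<le> exp (11 * E (real (j + B j))) * real (j + B j)"
      using E_nonneg[of "real (j + B j)"] B1[of j] by (intro mult_mono) auto
    then show ?thesis by (simp add: g_def)
  qed
  define D where "D = 1 + real (\<Sum>i<J. B i)"
  have D1: "1 \<le> D" unfolding D_def by (simp add: sum_nonneg)
  have BD: "real (B j) \<le> D + real j" for j
  proof (cases "J \<le> j")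
    case True
    then have "real (B j) \<le> real j" using J[OF True] by linarith
    then show ?thesis using D1 by linarith
  next
    case False
    then have "B j \<le> (\<Sum>i<J. B i)" by (intro member_le_sum) auto
    then have "real (B j) \<le> real (\<Sum>i<J. B i)" by (rule of_nat_mono)
    then show ?thesis unfolding D_def by linarith
  qed
  have gC: "g j \<le> (exp (11 * S) * (D + 2)) * (real j + 1)" for j
  proof -
    have "g j \<le> exp (11 * S) * ((D + 2) * (real j + 1))"
      unfolding g_def
    proof (intro mult_mono)
      have "D \<le> D * (real j + 1)" using D1 by (simp add: algebra_simps)
      then show "real (j + B j) \<le> (D + 2) * (real j + 1)"
        using BD[of j] by (simp add: algebra_simps)
    qed (use E_le in auto)
    then show ?thesis by (simp add: mult.assoc)
  qed
  have step: "\<exists>i i'. i' \<le> i \<and> i < j \<and> j + B j \<le> i + i' \<and> g i + g i' \<le> g j" if j: "3 * J + 4 < j" for j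
  proof -
    define v where "v = j + B j"
    have v: "4 < v" "8 * v \<le> 9 * j" "3 * J < v" using j J[of j] unfolding v_def by auto
    \<comment> \<open>The middle third is symmetric under the exchange of i and v - i. Its upper end
      keeps both pieces below j, since v <= 9/8 j; its lower end keeps both above \<open>J\<close>,
      where the loss is under control.\<close>
    define I where "I = {(v + 2) div 3..(2 * v) div 3}"
    have I: "v \<le> 3 * i" "3 * i \<le> 2 * v" if "i \<in> I" for i
      using that unfolding I_def by auto
    have cardI: "v \<le> 4 * card I" using v unfolding I_def by simp
    have bij: "bij_betw (\<lambda>i. v - i) I I"
      by (rule bij_betw_byWitness[where f'="\<lambda>i. v - i"]) (auto simp: I_def)
    \<comment> \<open>Some index does not exceed the mean: by symmetry the total of B i + B (v - i)
      over \<open>I\<close> is twice the sum of B, and \<open>I\<close> has at least v/4 elements,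
      which gives 2 * 4 = 8.\<close>
    have "\<exists>i\<in>I. real v * real (B i + B (v - i)) \<le> 8 * (\<Sum>i\<in>I. real (B i))"
    proof (rule ccontr)
      assume "\<not> ?thesis"
      then have c: "8 * (\<Sum>i\<in>I. real (B i)) < real v * real (B i + B (v - i))" if "i \<in> I" for i
        using that by force
      have ne: "I \<noteq> {}" using cardI v by auto
      have S0: "0 \<le> (\<Sum>i\<in>I. real (B i))" by (intro sum_nonneg) auto
      have cardI': "real v \<le> 4 * real (card I)" using cardI by linarith
      have "real (card I) * (8 * (\<Sum>i\<in>I. real (B i))) = (\<Sum>i\<in>I. 8 * (\<Sum>i\<in>I. real (B i)))" by simp
      also have "\<dots> < (\<Sum>i\<in>I. real v * real (B i + B (v - i)))"
        by (intro sum_strict_mono) (use ne c I_def in auto)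
      also have "\<dots> = real v * ((\<Sum>i\<in>I. real (B i)) + (\<Sum>i\<in>I. real (B (v - i))))"
        by (simp add: sum_distrib_left sum.distrib distrib_left)
      also have "(\<Sum>i\<in>I. real (B (v - i))) = (\<Sum>i\<in>I. real (B i))"
        using sum.reindex_bij_betw[OF bij, of "\<lambda>i. real (B i)"] by simp
      also have "real v * ((\<Sum>i\<in>I. real (B i)) + (\<Sum>i\<in>I. real (B i)))
          \<le> (4 * real (card I)) * (2 * (\<Sum>i\<in>I. real (B i)))"
        using cardI' S0 by (intro mult_mono) linarith+
      finally show False by simp
    qed
    then obtain i where i: "i \<in> I" "real v * real (B i + B (v - i)) \<le> 8 * (\<Sum>i\<in>I. real (B i))"
      by blast
    define i' where "i' = v - i"
    have i'I: "i' \<in> I" using bij i(1) unfolding i'_def bij_betw_def by blast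
    have ivv: "i + i' = v" using I[OF i(1)] unfolding i'_def by simp
    \<comment> \<open>k <= 2/3 v and B k <= k/8 give the factor 2/3 * 9/8 = 3/4; this is why
      \<open>E\<close> is compared at \<open>3/4 * v\<close> and \<open>v\<close>.\<close>
    have bnd: "real (k + B k) \<le> 3/4 * real v" if "k \<in> I" for k
    proof -
      have "J \<le> k" using I[OF that] v by linarith
      then show ?thesis using J[of k] I[OF that] by simp
    qed
    have lt: "k < j" if "k \<in> I" for k using I[OF that] v by linarith
    have gle: "g k \<le> exp (11 * E (3/4 * real v)) * real (k + B k)" if "k \<in> I" for k
      unfolding g_def using bnd[OF that] by (intro mult_right_mono) (auto intro!: E_mono)
    have Sum_le: "(\<Sum>i\<in>I. real (B i)) \<le> (real v)\<^sup>2 * (4/9) * (\<Sum>i\<in>I. t i)"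
      unfolding sum_distrib_left
    proof (rule sum_mono)
      fix k assume k: "k \<in> I"
      have kp: "0 < real k" using I[OF k] v by linarith
      have "real (B k) = (real k)\<^sup>2 * t k" using kp by (simp add: t_def)
      also have "\<dots> \<le> (2/3 * real v)\<^sup>2 * t k"
        using I[OF k] by (intro mult_right_mono power_mono t0) auto
      finally show "real (B k) \<le> (real v)\<^sup>2 * (4/9) * t k" by (simp add: power2_eq_square)
    qed
    have gap: "(3/8) * (\<Sum>i\<in>I. t i) \<le> E (real v) - E (3/4 * real v)"
    proof -
      have "(\<Sum>i\<in>I. t i * (3/8)) \<le> E (real v) - E (3/4 * real v)"
      proof (rule E_gap)
        show "real v \<le> 3 * real i \<and> 3 * real i \<le> 2 * real v" if "i \<in> I" for i
          using I[OF that] by linarith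
      qed (use v in \<open>auto simp: I_def\<close>)
      then show ?thesis unfolding sum_distrib_right[symmetric] by (simp only: mult.commute)
    qed
    have "real v * real (B i + B i') \<le> 8 * ((real v)\<^sup>2 * (4/9) * (\<Sum>i\<in>I. t i))"
      using i(2) Sum_le unfolding i'_def by linarith
    then have "real v * real (B i + B i') \<le> real v * (real v * (32/9) * (\<Sum>i\<in>I. t i))"
      by (simp add: power2_eq_square mult_ac)
    then have "real (B i + B i') \<le> real v * (32/9) * (\<Sum>i\<in>I. t i)"
      using v by simp
    \<comment> \<open>\<open>gap\<close> bounds the sum of t by 8/3 times the increment of
      \<open>E\<close>, and 32/9 * 8/3 = 256/27 < 11.\<close>
    also have "\<dots> \<le> real v * (11 * (E (real v) - E (3/4 * real v)))"
    proof -
      have "(32/9) * (\<Sum>i\<in>I. t i) \<le> 11 * (E (real v) - E (3/4 * real v))"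
        using gap sum_nonneg[of I t] t0 by simp
      then show ?thesis unfolding mult.assoc by (intro mult_left_mono) auto
    qed
    finally have Bl: "real v + real (B i + B i') \<le> real v * (1 + 11 * (E (real v) - E (3/4 * real v)))"
      by (simp add: algebra_simps)
    have "g i + g i' \<le> exp (11 * E (3/4 * real v)) * (real (i + B i) + real (i' + B i'))"
      using gle[OF i(1)] gle[OF i'I] by (simp only: distrib_left)
    also have "\<dots> = exp (11 * E (3/4 * real v)) * (real v + real (B i + B i'))"
      unfolding ivv[symmetric] by simp
    \<comment> \<open>With s = 11 times the increment of \<open>E\<close>, the inequality 1 + s <=
      exp s converts the relative loss of the split into the missing factor between the two values
      of exp(11 E).\<close>
    also have "\<dots> \<le> exp (11 * E (3/4 * real v)) * (real v * exp (11 * (E (real v) - E (3/4 * real v))))"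
      using Bl exp_ge_add_one_self[of "11 * (E (real v) - E (3/4 * real v))"]
      by (intro mult_left_mono order.trans[OF Bl]) auto
    also have "\<dots> = g j" unfolding g_def v_def[symmetric]
      by (simp add: exp_add[symmetric] algebra_simps flip: mult.assoc)
    finally have fin: "g i + g i' \<le> g j" .
    show ?thesis
    proof (cases "i' \<le> i")
      case True
      then show ?thesis using fin ivv lt[OF i(1)] unfolding v_def by (intro exI[of _ i] exI[of _ i']) auto
    next
      case False
      then show ?thesis using fin ivv lt[OF i'I] unfolding v_def
        by (intro exI[of _ i'] exI[of _ i]) auto
    qed
  qed
  have "0 < exp (11 * S) * (D + 2)" using D1 by simp
  then show ?thesis using gC g1 step by blast
qed

subsection \<open>Slow variation along powers of two\<close>

text \<open>The dilates of \<open>A\<close> by powers of two are disjoint, and the j-th has measure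
  at least 2^j / 2, so it contributes at least c j / 2 to the integral. Values in
  \<open>ennreal\<close> let the lemma apply to an integrand whose negative part is cut off.\<close>

lemma summable_of_dyadic_lower_bound:
  fixes g :: "real \<Rightarrow> ennreal" and c :: "nat \<Rightarrow> real"
  assumes g[measurable]: "g \<in> borel_measurable borel"
    and fin: "(\<integral>\<^sup>+ x. g x \<partial>lborel) < \<infinity>"
    and A[measurable]: "A \<in> sets borel" and A12: "A \<subseteq> {1..<2}" and mA: "ennreal (1/2) \<le> emeasure lborel A"
    and c0: "\<And>j. 0 \<le> c j"
    and lower: "\<And>j u. J \<le> j \<Longrightarrow> u \<in> A \<Longrightarrow> ennreal (c j / 2 ^ j) \<le> g (2 ^ j * u)"
  shows "summable c"
proof -
  define D where "D j = {x. x / 2 ^ j \<in> A}" for j :: nat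
  have D[measurable]: "D j \<in> sets borel" for j
    unfolding D_def by measurable
  have Dsub: "2 ^ j \<le> x \<and> x < 2 ^ Suc j" if "x \<in> D j" for x j
    using that A12 by (auto simp: D_def field_simps subset_iff dest!: spec)
  have disj: "disjoint_family_on D I" for I
  proof (unfold disjoint_family_on_def, intro ballI impI)
    fix i j :: nat assume "i \<noteq> j"
    have False if "i < j" "x \<in> D i" "x \<in> D j" for i j x
    proof -
      have "(2::real) ^ Suc i \<le> 2 ^ j" using that by (intro power_increasing) auto
      then show False using Dsub[OF that(2)] Dsub[OF that(3)] by linarith
    qed
    then show "D i \<inter> D j = {}" using \<open>i \<noteq> j\<close> by (cases i j rule: linorder_cases) auto
  qed
  have block: "ennreal (c j / 2) \<le> (\<integral>\<^sup>+ x. g x * indicator (D j) x \<partial>lborel)" if j: "J \<le> j" for j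
  proof -
    have "ennreal (c j / 2) = ennreal (2 ^ j) * (ennreal (c j / 2 ^ j) * ennreal (1/2))"
      using c0[of j] by (simp del: ennreal_half add: ennreal_mult[symmetric])
    also have "\<dots> \<le> ennreal (2 ^ j) * (ennreal (c j / 2 ^ j) * emeasure lborel A)"
      using mA by (intro mult_left_mono) auto
    also have "\<dots> = ennreal (2 ^ j) * (\<integral>\<^sup>+ u. ennreal (c j / 2 ^ j) * indicator A u \<partial>lborel)"
      by (simp add: nn_integral_cmult)
    also have "\<dots> \<le> ennreal (2 ^ j) * (\<integral>\<^sup>+ u. g (2 ^ j * u) * indicator (D j) (2 ^ j * u) \<partial>lborel)"
      using lower[OF j] by (intro mult_left_mono nn_integral_mono) (auto simp: D_def indicator_def)
    also have "\<dots> = (\<integral>\<^sup>+ x. g x * indicator (D j) x \<partial>lborel)"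
      by (subst nn_integral_real_affine[where c="2 ^ j" and t=0]) auto
    finally show ?thesis .
  qed
  have bound: "ennreal (\<Sum>j=J..<n. c j / 2) \<le> (\<integral>\<^sup>+ x. g x \<partial>lborel)" for n
  proof -
    have "ennreal (\<Sum>j=J..<n. c j / 2) = (\<Sum>j=J..<n. ennreal (c j / 2))"
      using c0 by (simp add: sum_ennreal)
    also have "\<dots> \<le> (\<Sum>j=J..<n. \<integral>\<^sup>+ x. g x * indicator (D j) x \<partial>lborel)"
      using block by (intro sum_mono) auto
    also have "\<dots> = (\<integral>\<^sup>+ x. (\<Sum>j=J..<n. g x * indicator (D j) x) \<partial>lborel)"
      by (intro nn_integral_sum[symmetric]) auto
    also have "\<dots> = (\<integral>\<^sup>+ x. g x * indicator (\<Union>j\<in>{J..<n}. D j) x \<partial>lborel)"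
      by (subst indicator_UN_disjoint[OF _ disj]) (auto simp: sum_distrib_left)
    also have "\<dots> \<le> (\<integral>\<^sup>+ x. g x \<partial>lborel)"
      by (intro nn_integral_mono) (auto simp: indicator_def)
    finally show ?thesis .
  qed
  define K where "K = enn2real (\<integral>\<^sup>+ x. g x \<partial>lborel)"
  have K: "(\<Sum>j=J..<n. c j / 2) \<le> K" for n
  proof -
    have "ennreal (\<Sum>j=J..<n. c j / 2) \<le> ennreal K"
      unfolding K_def using bound[of n] fin by (simp add: less_top[symmetric])
    moreover have "0 \<le> K" unfolding K_def by simp
    ultimately show ?thesis by (subst (asm) ennreal_le_iff) auto
  qed
  have "summable (\<lambda>j. c (j + J))"
  proof (rule summableI_nonneg_bounded)
    show "0 \<le> c (n + J)" for n using c0 .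
    show "(\<Sum>j<n. c (j + J)) \<le> 2 * K" for n
      using K[of "n + J"] sum.shift_bounds_nat_ivl[of c 0 J n]
      by (simp add: lessThan_atLeast0 sum_divide_distrib[symmetric])
  qed
  then show ?thesis by (simp add: summable_iff_shift)
qed

lemma filterlim_two_power: "filterlim (\<lambda>j. 2 ^ j :: real) at_top sequentially"
proof (rule filterlim_at_top_mono[OF filterlim_real_sequentially always_eventually], intro allI)
  show "real j \<le> 2 ^ j" for j
    using of_nat_less_two_power[of j, where ?'a=real] by simp
qed

text \<open>An Egorov argument replaces Karamata's uniform convergence theorem.\<close>

lemma slowly_varying_uniform_on_half:
  assumes SV: "slowly_varying L"
  shows "\<exists>A J. A \<in> sets borel \<and> A \<subseteq> {1..<2} \<and> ennreal (1/2) \<le> emeasure lborel A \<and>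
    (\<forall>j\<ge>J. \<forall>u\<in>A. L (2 ^ j) / 2 \<le> L (2 ^ j * u) \<and> L (2 ^ j * u) \<le> 2 * L (2 ^ j))"
proof -
  have [measurable]: "L \<in> borel_measurable borel" using SV by (simp add: slowly_varying_def)
  \<comment> \<open>The ratios whose good behaviour has begun by index J. Pointwise slow variation
    says that these sets increase to the whole interval, so continuity of measure gives one of
    measure at least 1/2.\<close>
  define A where "A J = {u \<in> {1..<2}. \<forall>j\<ge>J. L (2 ^ j) / 2 \<le> L (2 ^ j * u) \<and> L (2 ^ j * u) \<le> 2 * L (2 ^ j)}" for J :: nat
  have [measurable]: "A J \<in> sets borel" for J unfolding A_def by measurable
  have inc: "incseq A" unfolding A_def incseq_def by auto
  have "u \<in> (\<Union>J. A J)" if u: "u \<in> {1..<2}" for u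
  proof -
    have "((\<lambda>x. L (u * x) / L x) \<longlongrightarrow> 1) at_top"
      using SV u by (auto simp: slowly_varying_def)
    moreover have "filterlim (\<lambda>j. 2 ^ j :: real) at_top sequentially"
      by (rule filterlim_two_power)
    ultimately have "(\<lambda>j. L (u * 2 ^ j) / L (2 ^ j)) \<longlonglongrightarrow> 1"
      by (rule filterlim_compose)
    then have "eventually (\<lambda>j. L (u * 2 ^ j) / L (2 ^ j) \<in> {1/2<..<2}) sequentially"
      by (intro topological_tendstoD) auto
    then obtain J where J: "\<And>j. J \<le> j \<Longrightarrow> L (u * 2 ^ j) / L (2 ^ j) \<in> {1/2<..<2}"
      unfolding eventually_sequentially by blast
    have pos: "0 < L (2 ^ j)" for j :: nat using SV by (auto simp: slowly_varying_def)
    have "u \<in> A J" unfolding A_def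
    proof (intro CollectI conjI u allI impI)
      fix j assume "J \<le> j"
      then show "L (2 ^ j) / 2 \<le> L (2 ^ j * u)" "L (2 ^ j * u) \<le> 2 * L (2 ^ j)"
        using J[of j] pos[of j] by (auto simp: field_simps)
    qed
    then show ?thesis by blast
  qed
  then have UN: "(\<Union>J. A J) = {1..<2}" unfolding A_def by auto
  have "(\<lambda>J. emeasure lborel (A J)) \<longlonglongrightarrow> emeasure lborel (\<Union>J. A J)"
    by (intro Lim_emeasure_incseq inc) auto
  then have "(\<lambda>J. emeasure lborel (A J)) \<longlonglongrightarrow> 1" unfolding UN by simp
  moreover have "ennreal (1/2) < 1" unfolding ennreal_1[symmetric] by (subst ennreal_less_iff) auto
  ultimately have "eventually (\<lambda>J. ennreal (1/2) < emeasure lborel (A J)) sequentially"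
    by (rule order_tendstoD)
  then obtain J where "ennreal (1/2) \<le> emeasure lborel (A J)"
    unfolding eventually_sequentially by (meson less_imp_le order_refl)
  moreover have "A J \<in> sets borel" by measurable
  moreover have "A J \<subseteq> {1..<2}"
    "\<forall>j\<ge>J. \<forall>u\<in>A J. L (2 ^ j) / 2 \<le> L (2 ^ j * u) \<and> L (2 ^ j * u) \<le> 2 * L (2 ^ j)"
    by (auto simp: A_def)
  ultimately show ?thesis by blast
qed

lemma summable_L_dyadic:
  assumes SV: "slowly_varying L"
    and int1: "(\<integral>\<^sup>+ x \<in> {1..}. ennreal (L x / x) \<partial>lborel) < \<infinity>"
  shows "summable (\<lambda>j. L (2 ^ j))"
proof -
  have [measurable]: "L \<in> borel_measurable borel" using SV by (simp add: slowly_varying_def)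
  have pos: "0 < L (2 ^ j)" for j :: nat using SV by (auto simp: slowly_varying_def)
  obtain A J where A: "A \<in> sets borel" "A \<subseteq> {1..<2}" "ennreal (1/2) \<le> emeasure lborel A"
    and AJ: "\<And>j u. J \<le> j \<Longrightarrow> u \<in> A \<Longrightarrow> L (2 ^ j) / 2 \<le> L (2 ^ j * u) \<and> L (2 ^ j * u) \<le> 2 * L (2 ^ j)"
    using slowly_varying_uniform_on_half[OF SV] by blast
  \<comment> \<open>One factor 2 is the tolerance on the ratio of the values of L, the other comes
    from u < 2 in the denominator.\<close>
  have "summable (\<lambda>j. L (2 ^ j) / 4)"
  proof (rule summable_of_dyadic_lower_bound[OF _ _ A])
    show "(\<lambda>x. ennreal (L x / x) * indicator {1..} x) \<in> borel_measurable borel" by measurable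
    show "(\<integral>\<^sup>+ x. ennreal (L x / x) * indicator {1..} x \<partial>lborel) < \<infinity>" by fact
    show "0 \<le> L (2 ^ j) / 4" for j using pos[of j] by simp
    fix j u assume j: "J \<le> j" and u: "u \<in> A"
    have u12: "1 \<le> u" "u < 2" using A(2) u by auto
    have "1 * 1 \<le> 2 ^ j * u" using u12 by (intro mult_mono) auto
    moreover have "L (2 ^ j) / 4 / 2 ^ j \<le> L (2 ^ j * u) / (2 ^ j * u)"
    proof -
      have "L (2 ^ j) / 4 / 2 ^ j = (L (2 ^ j) / 2) / (2 ^ j * 2)" by simp
      also have "\<dots> \<le> L (2 ^ j * u) / (2 ^ j * u)"
        using AJ[OF j u] u12 pos[of j] by (intro frac_le) auto
      finally show ?thesis .
    qed
    ultimately show "ennreal (L (2 ^ j) / 4 / 2 ^ j)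
        \<le> ennreal (L (2 ^ j * u) / (2 ^ j * u)) * indicator {1..} (2 ^ j * u)"
      by (simp add: ennreal_leI)
  qed
  from summable_mult[OF this, of 4] show ?thesis by simp
qed

lemma summable_neg_ln_L_dyadic:
  assumes SV: "slowly_varying L"
    and int2: "(\<integral>\<^sup>+ x \<in> {1<..}. ennreal (- ln (L x) / (x * (ln x)\<^sup>2)) \<partial>lborel) < \<infinity>"
  shows "summable (\<lambda>j. max 0 (- ln (L (2 ^ j))) / (real j)\<^sup>2)"
proof -
  have [measurable]: "L \<in> borel_measurable borel" using SV by (simp add: slowly_varying_def)
  have pos: "0 < L (2 ^ j)" for j :: nat using SV by (auto simp: slowly_varying_def)
  obtain A J where A: "A \<in> sets borel" "A \<subseteq> {1..<2}" "ennreal (1/2) \<le> emeasure lborel A"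
    and AJ: "\<And>j u. J \<le> j \<Longrightarrow> u \<in> A \<Longrightarrow> L (2 ^ j) / 2 \<le> L (2 ^ j * u) \<and> L (2 ^ j * u) \<le> 2 * L (2 ^ j)"
    using slowly_varying_uniform_on_half[OF SV] by blast
  \<comment> \<open>L may double between 2^j and 2^j u, so ln 2 is subtracted here and put back at
    the end through the convergent sum of ln 2 / j^2. The 8 below is 2 * 2^2, from x <= 2 * 2^j and
    ln x <= 2 j; starting at \<open>Suc J\<close> makes j positive, so that x lies in the range of
    integration.\<close>
  define h where "h j = max 0 (- ln (L (2 ^ j)) - ln 2)" for j :: nat
  have sh: "summable (\<lambda>j. h j / (8 * (real j)\<^sup>2))"
  proof (rule summable_of_dyadic_lower_bound[OF _ _ A, where J="Suc J"])
    show "(\<lambda>x. ennreal (- ln (L x) / (x * (ln x)\<^sup>2)) * indicator {1<..} x) \<in> borel_measurable borel"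
      by measurable
    show "(\<integral>\<^sup>+ x. ennreal (- ln (L x) / (x * (ln x)\<^sup>2)) * indicator {1<..} x \<partial>lborel) < \<infinity>" by fact
    show "0 \<le> h j / (8 * (real j)\<^sup>2)" for j unfolding h_def by simp
    fix j u assume j: "Suc J \<le> j" and u: "u \<in> A"
    have u12: "1 \<le> u" "u < 2" using A(2) u by auto
    define x where "x = 2 ^ j * u"
    have "(2::real) ^ 1 \<le> 2 ^ j" using j by (intro power_increasing) auto
    moreover have "2 ^ j * 1 \<le> x" unfolding x_def using u12 by (intro mult_left_mono) auto
    ultimately have x1: "2 \<le> x" by simp
    have x2: "x \<le> 2 ^ j * 2" unfolding x_def using u12 by (intro mult_left_mono) auto
    have lx: "0 < ln x" using x1 by simp
    have "ln x \<le> ln (2 ^ Suc j)" using x1 x2 by simp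
    also have "\<dots> = real (Suc j) * ln 2" by (rule ln_realpow)
    also have "\<dots> \<le> (2 * real j) * 1" using j ln_2_less_1 by (intro mult_mono) simp_all
    finally have lx2: "ln x \<le> 2 * real j" by simp
    have "ennreal (h j / (8 * (real j)\<^sup>2) / 2 ^ j) \<le> ennreal (- ln (L x) / (x * (ln x)\<^sup>2))"
    proof (cases "h j = 0")
      case False
      then have hj: "h j = - ln (L (2 ^ j)) - ln 2" "0 < h j" unfolding h_def by (auto simp: max_def split: if_splits)
      have Lx: "0 < L x" using AJ[of j u] j u pos[of j] unfolding x_def by simp
      have "ln (L x) \<le> ln (2 * L (2 ^ j))"
        using AJ[of j u] j u pos[of j] Lx unfolding x_def by (subst ln_le_cancel_iff) auto
      then have hx: "h j \<le> - ln (L x)" using pos[of j] hj by (simp add: ln_mult)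
      have "h j / (8 * (real j)\<^sup>2) / 2 ^ j = h j / ((2 ^ j * 2) * (2 * real j)\<^sup>2)"
        by (simp add: power2_eq_square)
      also have "\<dots> \<le> - ln (L x) / (x * (ln x)\<^sup>2)"
        using hx hj x1 x2 lx lx2 by (intro frac_le mult_mono power_mono mult_pos_pos) auto
      finally show ?thesis by (rule ennreal_leI)
    qed simp
    then show "ennreal (h j / (8 * (real j)\<^sup>2) / 2 ^ j)
        \<le> ennreal (- ln (L (2 ^ j * u)) / (2 ^ j * u * (ln (2 ^ j * u))\<^sup>2)) * indicator {1<..} (2 ^ j * u)"
      using x1 unfolding x_def by simp
  qed
  have "summable (\<lambda>j. 1 / (real j)\<^sup>2)"
    using inverse_power_summable[of 2, where ?'a=real] by (simp add: inverse_eq_divide)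
  then have "summable (\<lambda>j. 8 * (h j / (8 * (real j)\<^sup>2)) + ln 2 * (1 / (real j)\<^sup>2))"
    by (intro summable_add summable_mult sh)
  then show ?thesis
  proof (rule summable_comparison_test'[where N=0])
    show "norm (max 0 (- ln (L (2 ^ j))) / (real j)\<^sup>2) \<le> 8 * (h j / (8 * (real j)\<^sup>2)) + ln 2 * (1 / (real j)\<^sup>2)" for j
    proof -
      have "max 0 (- ln (L (2 ^ j))) \<le> h j + ln 2" unfolding h_def by (auto simp: max_def)
      then have "max 0 (- ln (L (2 ^ j))) / (real j)\<^sup>2 \<le> (h j + ln 2) / (real j)\<^sup>2"
        by (intro divide_right_mono) auto
      then show ?thesis by (simp add: add_divide_distrib)
    qed
  qed
qed

text \<open>The increments of ln L along powers of two tend to 0. This gives the pointwise bound 8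
  B(j) <= j at large scales, which summability of B(j) / j^2 does not imply, since B may have sparse
  peaks.\<close>

lemma neg_ln_L_dyadic_sublinear:
  assumes SV: "slowly_varying L" and e: "0 < (e::real)"
  shows "eventually (\<lambda>j. - ln (L (2 ^ j)) \<le> e * real j) sequentially"
proof -
  have pos: "0 < L (2 ^ j)" for j :: nat using SV by (auto simp: slowly_varying_def)
  have "((\<lambda>x. L (2 * x) / L x) \<longlongrightarrow> 1) at_top" using SV by (auto simp: slowly_varying_def)
  moreover have "filterlim (\<lambda>j. 2 ^ j :: real) at_top sequentially"
    by (rule filterlim_two_power)
  ultimately have "(\<lambda>j. L (2 * 2 ^ j) / L (2 ^ j)) \<longlonglongrightarrow> 1"
    by (rule filterlim_compose)
  then have "(\<lambda>j. ln (L (2 * 2 ^ j) / L (2 ^ j))) \<longlonglongrightarrow> ln 1"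
    by (intro tendsto_ln) auto
  then have "eventually (\<lambda>j. - (e/2) < ln (L (2 * 2 ^ j) / L (2 ^ j))) sequentially"
    using e by (intro order_tendstoD) auto
  then obtain J where J: "\<And>j. J \<le> j \<Longrightarrow> - (e/2) < ln (L (2 * 2 ^ j) / L (2 ^ j))"
    unfolding eventually_sequentially by blast
  have step: "- ln (L (2 ^ (J + n))) \<le> - ln (L (2 ^ J)) + e/2 * real n" for n
  proof (induction n)
    case (Suc n)
    have "ln (L (2 * 2 ^ (J + n)) / L (2 ^ (J + n))) = ln (L (2 ^ (J + Suc n))) - ln (L (2 ^ (J + n)))"
      using pos[of "J + n"] pos[of "J + Suc n"] by (simp add: ln_div)
    then show ?case using J[of "J + n"] Suc by (simp add: algebra_simps)
  qed simp
  have "eventually (\<lambda>j::nat. 2 * \<bar>ln (L (2 ^ J))\<bar> / e \<le> real j) sequentially"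
    using filterlim_real_sequentially by (simp add: filterlim_at_top)
  then show ?thesis using eventually_ge_at_top[of J]
  proof eventually_elim
    case (elim j)
    have "2 * \<bar>ln (L (2 ^ J))\<bar> \<le> e * real j" using elim e by (simp add: field_simps)
    moreover have "e/2 * real (j - J) \<le> e/2 * real j" using e by (intro mult_left_mono) auto
    ultimately show ?case using step[of "j - J"] elim by simp
  qed
qed

subsection \<open>Passage times along paths inside a set\<close>

text \<open>Truncation at 0 makes costs nonnegative for every configuration; almost surely it changes nothing.\<close>

definition cost :: "(real \<Rightarrow> real) \<Rightarrow> ((int ^ 'd) set \<Rightarrow> real) \<Rightarrow> int ^ 'd \<Rightarrow> int ^ 'd \<Rightarrow> real" where
  "cost L w x y = max 0 (w {x, y}) / rate CARD('d) L (norm1 (x - y))"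

fun path_cost :: "(real \<Rightarrow> real) \<Rightarrow> ((int ^ 'd) set \<Rightarrow> real) \<Rightarrow> (int ^ 'd) list \<Rightarrow> real" where
  "path_cost L w (x # y # p) = cost L w x y + path_cost L w (y # p)"
| "path_cost L w p = 0"

definition paths_in :: "(int ^ 'd) set \<Rightarrow> int ^ 'd \<Rightarrow> int ^ 'd \<Rightarrow> (int ^ 'd) list set" where
  "paths_in Q x y = {p. is_path p \<and> set p \<subseteq> Q \<and> hd p = x \<and> last p = y}"

text \<open>Confining the whole path to Q, and not just its end points, makes this a function of the
  edges inside Q, hence independent for disjoint sets.\<close>

definition dist_in :: "(real \<Rightarrow> real) \<Rightarrow> (int ^ 'd) set \<Rightarrow> ((int ^ 'd) set \<Rightarrow> real) \<Rightarrow> int ^ 'd \<Rightarrow> int ^ 'd \<Rightarrow> real" where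
  "dist_in L Q w x y = Inf (path_cost L w ` paths_in Q x y)"

definition edges_in :: "(int ^ 'd) set \<Rightarrow> (int ^ 'd) set set" where
  "edges_in Q = {e \<in> edges. e \<subseteq> Q}"

lemma norm1_nonneg: "0 \<le> norm1 x"
  unfolding norm1_def by (intro sum_nonneg) auto

lemma norm1_eq_0_iff [simp]: "norm1 x = 0 \<longleftrightarrow> x = 0"
  unfolding norm1_def by (subst sum_nonneg_eq_0_iff) (auto simp: vec_eq_iff)

lemma norm1_zero [simp]: "norm1 0 = 0" by (simp add: norm1_def)

lemma norm1_minus_commute: "norm1 (x - y) = norm1 (y - x)"
  unfolding norm1_def by (intro sum.cong) auto

lemma norm1_triangle: "norm1 (x - z) \<le> norm1 (x - y) + norm1 (y - z)"
  unfolding norm1_def sum.distrib[symmetric] by (intro sum_mono) auto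

lemma norm1_eq_of_nat: "\<exists>n. norm1 x = real n"
proof
  show "norm1 x = real (nat (\<Sum>i\<in>UNIV. \<bar>x $ i\<bar>))"
    unfolding norm1_def by (simp add: sum_nonneg)
qed

lemma norm1_ge_1: "x \<noteq> 0 \<Longrightarrow> 1 \<le> norm1 x"
  using norm1_eq_of_nat[of x] norm1_eq_0_iff[of x] by (auto simp del: norm1_eq_0_iff)

lemma rate_pos: "slowly_varying L \<Longrightarrow> 1 \<le> k \<Longrightarrow> 0 < rate d L k"
  by (auto simp: rate_def slowly_varying_def)

lemma cost_nonneg:
  fixes x y :: "int ^ 'd"
  assumes "slowly_varying L" shows "0 \<le> cost L w x y"
proof (cases "x = y")
  case True then show ?thesis by (simp add: cost_def rate_def)
next
  case False
  then have "0 < rate CARD('d) L (norm1 (x - y))"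
    by (intro rate_pos assms norm1_ge_1) auto
  then show ?thesis by (simp add: cost_def)
qed

lemma path_cost_nonneg: "slowly_varying L \<Longrightarrow> 0 \<le> path_cost L w p"
  by (induction L w p rule: path_cost.induct) (auto intro!: add_nonneg_nonneg cost_nonneg)

lemma is_path_Nil [simp]: "\<not> is_path []" by (simp add: is_path_def)

lemma is_path_single [simp]: "is_path [x]" by (simp add: is_path_def)

lemma is_path_Cons2 [simp]: "is_path (x # y # p) \<longleftrightarrow> x \<noteq> y \<and> is_path (y # p)"
  unfolding is_path_def by (auto simp: less_Suc_eq_0_disj nth_Cons')

lemma is_path_append:
  "p \<noteq> [] \<Longrightarrow> q \<noteq> [] \<Longrightarrow> is_path (p @ q) \<longleftrightarrow> is_path p \<and> is_path q \<and> last p \<noteq> hd q"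
proof (induction p rule: induct_list012)
  case (2 x) then show ?case by (cases q) auto
qed auto

lemma path_cost_append:
  "p \<noteq> [] \<Longrightarrow> q \<noteq> [] \<Longrightarrow> path_cost L w (p @ q) = path_cost L w p + cost L w (last p) (hd q) + path_cost L w q"
proof (induction p rule: induct_list012)
  case (2 x) then show ?case by (cases q) auto
qed auto

lemma path_cost_suffix_le:
  "slowly_varying L \<Longrightarrow> path_cost L w q \<le> path_cost L w (p @ q)"
  using path_cost_append[of p q L w] cost_nonneg[of L w "last p" "hd q"] path_cost_nonneg[of L w p]
    path_cost_nonneg[of L w "p @ q"]
  by (cases "p = []"; cases "q = []") auto

lemma edge_in_edges: "x \<noteq> y \<Longrightarrow> {x, y} \<in> edges" by (auto simp: edges_def)

lemma path_cost_cong: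
  "is_path p \<Longrightarrow> set p \<subseteq> Q \<Longrightarrow> (\<And>e. e \<in> edges_in Q \<Longrightarrow> w e = w' e) \<Longrightarrow> path_cost L w p = path_cost L w' p"
proof (induction p rule: induct_list012)
  case (3 x y p)
  then have "{x, y} \<in> edges_in Q" by (auto simp: edges_in_def edge_in_edges)
  then show ?case using 3 by (simp add: cost_def)
qed auto

lemma dist_in_cong:
  "(\<And>e. e \<in> edges_in Q \<Longrightarrow> w e = w' e) \<Longrightarrow> dist_in L Q w x y = dist_in L Q w' x y"
  unfolding dist_in_def using path_cost_cong[of _ Q w w' L] 
  by (intro arg_cong[where f=Inf] image_cong) (auto simp: paths_in_def)

lemma dist_in_le:
  assumes "slowly_varying L" "p \<in> paths_in Q x y" shows "dist_in L Q w x y \<le> path_cost L w p"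
  unfolding dist_in_def
  by (intro cInf_lower imageI assms bdd_belowI2[of _ 0] path_cost_nonneg)

lemma paths_in_nonempty: "x \<in> Q \<Longrightarrow> y \<in> Q \<Longrightarrow> paths_in Q x y \<noteq> {}"
proof -
  assume "x \<in> Q" "y \<in> Q"
  then have "(if x = y then [x] else [x, y]) \<in> paths_in Q x y" by (auto simp: paths_in_def)
  then show ?thesis by blast
qed

lemma dist_in_nonneg:
  assumes "slowly_varying L" "x \<in> Q" "y \<in> Q" shows "0 \<le> dist_in L Q w x y"
  unfolding dist_in_def using paths_in_nonempty[OF assms(2,3)] path_cost_nonneg[OF assms(1)]
  by (intro cInf_greatest) auto

lemma dist_in_refl:
  assumes "slowly_varying L" "x \<in> Q" shows "dist_in L Q w x x = 0"
  using dist_in_le[OF assms(1), of "[x]" Q x x w] dist_in_nonneg[OF assms(1,2,2), of w] assms(2)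
  by (auto simp: paths_in_def)

lemma dist_in_le_cost:
  assumes "slowly_varying L" "x \<in> Q" "y \<in> Q" "x \<noteq> y" shows "dist_in L Q w x y \<le> cost L w x y"
  using dist_in_le[OF assms(1), of "[x, y]" Q x y w] assms by (auto simp: paths_in_def)

lemma dist_in_antimono:
  assumes "slowly_varying L" "x \<in> A" "y \<in> A" "A \<subseteq> Q" shows "dist_in L Q w x y \<le> dist_in L A w x y"
  unfolding dist_in_def using assms paths_in_nonempty[OF assms(2,3)]
  by (intro cInf_superset_mono image_mono bdd_belowI2[of _ 0] path_cost_nonneg)
     (auto simp: paths_in_def)

lemma dist_in_less_obtain:
  assumes "x \<in> Q" "y \<in> Q" "dist_in L Q w x y < t"
  obtains p where "p \<in> paths_in Q x y" "path_cost L w p < t"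
  using cInf_lessD[of "path_cost L w ` paths_in Q x y" t] assms paths_in_nonempty[OF assms(1,2)]
  unfolding dist_in_def by auto

lemma dist_in_crossing:
  assumes SV: "slowly_varying L" and "A \<subseteq> Q" "B \<subseteq> Q" "x \<in> A" "u \<in> A" "v \<in> B" "y \<in> B" "u \<noteq> v"
  shows "dist_in L Q w x y \<le> dist_in L A w x u + cost L w u v + dist_in L B w v y"
proof (rule field_le_epsilon)
  fix e :: real assume e: "0 < e"
  obtain p where p: "p \<in> paths_in A x u" "path_cost L w p < dist_in L A w x u + e / 2"
    using assms e by (elim dist_in_less_obtain[of x A u L w "dist_in L A w x u + e / 2", rotated -1]) auto
  obtain q where q: "q \<in> paths_in B v y" "path_cost L w q < dist_in L B w v y + e / 2"
    using assms e by (elim dist_in_less_obtain[of v B y L w "dist_in L B w v y + e / 2", rotated -1]) auto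
  have ne: "p \<noteq> []" "q \<noteq> []" using p q by (auto simp: paths_in_def)
  have "p @ q \<in> paths_in Q x y"
    using p q assms ne by (auto simp: paths_in_def is_path_append)
  from dist_in_le[OF SV this, of w]
  have "dist_in L Q w x y \<le> path_cost L w p + cost L w u v + path_cost L w q"
    using path_cost_append[OF ne, of L w] p q by (simp add: paths_in_def)
  then show "dist_in L Q w x y \<le> dist_in L A w x u + cost L w u v + dist_in L B w v y + e"
    using p q by simp
qed

text \<open>Loop erasure: if the new first vertex recurs, the path is cut back to the suffix
  starting there, which is no dearer since costs are nonnegative. A simple path never reuses an
  edge, so its step weights are independent.\<close>

lemma obtain_simple_path:
  assumes SV: "slowly_varying L" and "is_path p"
  obtains q where "is_path q" "distinct q" "hd q = hd p" "last q = last p" "path_cost L w q \<le> path_cost L w p"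
proof -
  have "\<exists>q. is_path q \<and> distinct q \<and> hd q = hd p \<and> last q = last p \<and> path_cost L w q \<le> path_cost L w p"
    using assms(2)
  proof (induction p rule: induct_list012)
    case (2 x) then show ?case by (intro exI[of _ "[x]"]) auto
  next
    case (3 x y p)
    then obtain q where q: "is_path q" "distinct q" "hd q = y" "last q = last (y # p)"
      "path_cost L w q \<le> path_cost L w (y # p)" by auto
    show ?case
    proof (cases "x \<in> set q")
      case True
      then obtain as bs where ab: "q = as @ x # bs" by (meson split_list)
      have "is_path (x # bs)"
        using q(1) is_path_append[of as "x # bs"] unfolding ab by (cases "as = []") auto
      then show ?thesis
        using q path_cost_suffix_le[OF SV, of w "x # bs" as] cost_nonneg[OF SV, of w x y] unfolding ab
        by (intro exI[of _ "x # bs"]) auto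
    next
      case False
      obtain q' where q': "q = y # q'" using q by (cases q) auto
      show ?thesis using q False 3 unfolding q' by (intro exI[of _ "x # y # q'"]) auto
    qed
  qed simp
  then show ?thesis using that by blast
qed

lemma countable_edges: "countable (edges :: (int ^ 'd) set set)"
proof -
  have "edges \<subseteq> (\<lambda>(x, y). {x, y}) ` (UNIV :: ((int ^ 'd) \<times> (int ^ 'd)) set)"
    by (auto simp: edges_def)
  then show ?thesis by (rule countable_subset) (intro countable_image countableI_type)
qed

lemma path_cost_measurable:
  "is_path p \<Longrightarrow> set p \<subseteq> Q \<Longrightarrow> (\<lambda>w. path_cost L w p) \<in> borel_measurable (PiM (edges_in Q) (\<lambda>_. borel))"
proof (induction p rule: induct_list012)
  case (3 x y p)
  then have e: "{x, y} \<in> edges_in Q" by (auto simp: edges_in_def edge_in_edges)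
  have [measurable]: "(\<lambda>w. w {x, y}) \<in> borel_measurable (PiM (edges_in Q) (\<lambda>_. borel))"
    using e by (rule measurable_component_singleton)
  have [measurable]: "(\<lambda>w. path_cost L w (y # p)) \<in> borel_measurable (PiM (edges_in Q) (\<lambda>_. borel))"
    using 3 by auto
  show ?case unfolding path_cost.simps cost_def by measurable
qed auto

text \<open>Measurability with respect to the coordinates in \<open>edges_in Q\<close> alone is what
  later turns disjointness of edge sets into independence. The infimum runs over countably many
  paths.\<close>

lemma dist_in_measurable:
  "(\<lambda>w. dist_in L Q w x y) \<in> borel_measurable (PiM (edges_in Q) (\<lambda>_. borel))"
  unfolding dist_in_def
proof (rule borel_measurable_cINF_real)
  show "countable (paths_in Q x y)" by (rule countableI_type)
  show "(\<lambda>w. path_cost L w p) \<in> borel_measurable (PiM (edges_in Q) (\<lambda>_. borel))" if "p \<in> paths_in Q x y" for p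
    using that by (intro path_cost_measurable) (auto simp: paths_in_def)
qed

lemma path_weight_eq_path_cost:
  assumes "is_path p" "\<And>e. e \<in> edges \<Longrightarrow> 0 \<le> \<omega> e s"
  shows "path_weight L \<omega> s p = path_cost L (\<lambda>e. \<omega> e s) p"
  using assms(1)
proof (induction p rule: induct_list012)
  case (3 x y p)
  have "path_weight L \<omega> s (x # y # p) = edge_weight L \<omega> s x y + path_weight L \<omega> s (y # p)"
    unfolding path_weight_def by (simp add: sum.lessThan_Suc_shift del: sum.lessThan_Suc)
  moreover have "edge_weight L \<omega> s x y = cost L (\<lambda>e. \<omega> e s) x y"
    using 3 assms(2)[OF edge_in_edges[of x y]] by (simp add: edge_weight_def cost_def)
  ultimately show ?case using 3 by simp
qed (auto simp: path_weight_def)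

lemma passage_time_eq_dist_in:
  assumes "\<And>e. e \<in> edges \<Longrightarrow> 0 \<le> \<omega> e s"
  shows "passage_time L \<omega> s x y = dist_in L UNIV (\<lambda>e. \<omega> e s) x y"
proof -
  have "{path_weight L \<omega> s p | p. is_path p \<and> hd p = x \<and> last p = y}
      = path_weight L \<omega> s ` paths_in UNIV x y"
    by (auto simp: paths_in_def)
  also have "\<dots> = path_cost L (\<lambda>e. \<omega> e s) ` paths_in UNIV x y"
    by (intro image_cong refl path_weight_eq_path_cost assms) (auto simp: paths_in_def)
  finally show ?thesis by (simp add: passage_time_def dist_in_def)
qed

lemma passage_time_measurable:
  assumes "\<And>e. e \<in> edges \<Longrightarrow> \<omega> e \<in> borel_measurable M"
  shows "(\<lambda>s. passage_time L \<omega> s x y) \<in> borel_measurable M"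
proof -
  have "(\<lambda>s. path_weight L \<omega> s p) \<in> borel_measurable M" if "is_path p" for p
  proof -
    have *: "(\<lambda>s. \<omega> {p ! i, p ! Suc i} s) \<in> borel_measurable M" if "i < length p - 1" for i
      using assms[OF edge_in_edges[of "p ! i" "p ! Suc i"]] \<open>is_path p\<close> that
      by (simp add: is_path_def)
    show ?thesis unfolding path_weight_def edge_weight_def
    proof (rule borel_measurable_sum)
      fix i assume "i \<in> {..<length p - 1}"
      then have [measurable]: "(\<lambda>s. \<omega> {p ! i, p ! Suc i} s) \<in> borel_measurable M" by (simp add: *)
      show "(\<lambda>s. \<omega> {p ! i, p ! Suc i} s / rate CARD('d) L (norm1 (p ! i - p ! Suc i))) \<in> borel_measurable M"
        by measurable
    qed
  qed
  then have "(\<lambda>s. INF p\<in>{p. is_path p \<and> hd p = x \<and> last p = y}. path_weight L \<omega> s p) \<in> borel_measurable M"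
    by (intro borel_measurable_cINF_real) (auto intro: countableI_type)
  moreover have "(INF p\<in>{p. is_path p \<and> hd p = x \<and> last p = y}. path_weight L \<omega> s p)
      = passage_time L \<omega> s x y" for s
    unfolding passage_time_def setcompr_eq_image ..
  ultimately show ?thesis by simp
qed

subsection \<open>Dyadic boxes\<close>

lemma finite_vec_box:
  fixes S :: "'d::finite \<Rightarrow> 'b set"
  assumes "\<And>k. finite (S k)"
  shows "finite {z :: 'b ^ 'd. \<forall>k. z $ k \<in> S k}"
    and "card {z :: 'b ^ 'd. \<forall>k. z $ k \<in> S k} = (\<Prod>k\<in>UNIV. card (S k))"
proof -
  have bij: "bij_betw vec_nth {z :: 'b ^ 'd. \<forall>k. z $ k \<in> S k} (PiE UNIV S)"
    by (rule bij_betw_byWitness[where f'=vec_lambda]) (auto simp: PiE_def)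
  have "finite (PiE UNIV S)" using assms by (intro finite_PiE) auto
  with bij show "finite {z :: 'b ^ 'd. \<forall>k. z $ k \<in> S k}" by (simp add: bij_betw_finite)
  show "card {z :: 'b ^ 'd. \<forall>k. z $ k \<in> S k} = (\<Prod>k\<in>UNIV. card (S k))"
    using bij_betw_same_card[OF bij] by (simp add: card_PiE)
qed

text \<open>Boxes of one grid are nested across scales. The grid offset \<open>c\<close> is free
  because in a fixed grid two points can be separated at every scale: with \<open>c = 0\<close>, the
  coordinates 0 and -1 never fall into the same interval. For the pair 0, x the offset will be the
  lower corner of the rectangle that they span.\<close>

definition dyadic_box :: "int ^ 'd \<Rightarrow> nat \<Rightarrow> int ^ 'd \<Rightarrow> (int ^ 'd) set" where
  "dyadic_box c j y = {z. \<forall>k. (z $ k - c $ k) div 2 ^ j = (y $ k - c $ k) div 2 ^ j}"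

lemma self_in_dyadic_box [simp]: "y \<in> dyadic_box c j y"
  by (simp add: dyadic_box_def)

lemma dyadic_box_eq: "z \<in> dyadic_box c j y \<Longrightarrow> dyadic_box c j z = dyadic_box c j y"
  by (auto simp: dyadic_box_def)

lemma dyadic_box_mono:
  assumes "i \<le> j" shows "dyadic_box c i y \<subseteq> dyadic_box c j y"
proof -
  have "a div 2 ^ j = a div 2 ^ i div 2 ^ (j - i)" for a :: int
    using assms by (simp add: zdiv_zmult2_eq[symmetric] power_add[symmetric])
  then show ?thesis by (auto simp: dyadic_box_def)
qed

lemma div_eq_atLeastLessThan: "{z :: int. (z - c) div 2 ^ j = q} = {c + 2 ^ j * q ..< c + 2 ^ j * (q + 1)}"
proof -
  have D: "(z - c) div 2 ^ j = q \<longleftrightarrow> 2 ^ j * q \<le> z - c \<and> z - c < 2 ^ j * (q + 1)" for z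
  proof
    assume q: "(z - c) div 2 ^ j = q"
    define r where "r = (z - c) mod 2 ^ j"
    have "z - c = 2 ^ j * q + r" unfolding q[symmetric] r_def by simp
    moreover have "0 \<le> r" "r < 2 ^ j" unfolding r_def by auto
    moreover have "2 ^ j * (q + 1) = 2 ^ j * q + 2 ^ j" by (simp add: distrib_left)
    ultimately show "2 ^ j * q \<le> z - c \<and> z - c < 2 ^ j * (q + 1)" by linarith
  next
    assume *: "2 ^ j * q \<le> z - c \<and> z - c < 2 ^ j * (q + 1)"
    define r where "r = z - c - 2 ^ j * q"
    have "2 ^ j * (q + 1) = 2 ^ j * q + 2 ^ j" by (simp add: distrib_left)
    then have "z - c = 2 ^ j * q + r" "0 \<le> r" "r < 2 ^ j" using * unfolding r_def by linarith+
    then show "(z - c) div 2 ^ j = q" by (rule int_div_pos_eq)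
  qed
  have "(z - c) div 2 ^ j = q \<longleftrightarrow> c + 2 ^ j * q \<le> z \<and> z < c + 2 ^ j * (q + 1)" for z
    by (simp only: D le_diff_eq diff_less_eq add.commute[of c])
  then show ?thesis by (simp only: set_eq_iff mem_Collect_eq atLeastLessThan_iff) blast
qed

lemma dyadic_box_as_product:
  "dyadic_box c j y = {z. \<forall>k. z $ k \<in> {c $ k + 2 ^ j * ((y $ k - c $ k) div 2 ^ j) ..<
      c $ k + 2 ^ j * ((y $ k - c $ k) div 2 ^ j + 1)}}"
  unfolding dyadic_box_def div_eq_atLeastLessThan[symmetric] by simp

lemma finite_dyadic_box: "finite (dyadic_box c j y)"
  unfolding dyadic_box_as_product by (rule finite_vec_box) simp

lemma card_dyadic_box: "card (dyadic_box (c :: int ^ 'd) j y) = 2 ^ (j * CARD('d))"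
proof -
  have "card (dyadic_box c j y) = (\<Prod>k\<in>(UNIV :: 'd set). 2 ^ j)"
    unfolding dyadic_box_as_product
    by (subst finite_vec_box(2)) (simp_all add: distrib_left nat_power_eq)
  then show ?thesis by (simp add: power_mult)
qed

text \<open>Each coordinate differs by at most 2^j. Bounding the dimension by 2 to its power keeps
  the diameter a power of two, where the rate is expressed by the dyadic values of L.\<close>

lemma norm1_le_in_dyadic_box:
  assumes "u \<in> dyadic_box (c :: int ^ 'd) j y" "v \<in> dyadic_box c j y"
  shows "norm1 (u - v) \<le> 2 ^ (j + CARD('d))"
proof -
  have "\<bar>u $ k - v $ k\<bar> \<le> 2 ^ j" for k
  proof -
    define a where "a = c $ k + 2 ^ j * ((y $ k - c $ k) div 2 ^ j)"
    have "w $ k \<in> {a..<a + 2 ^ j}" if "w \<in> dyadic_box c j y" for w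
    proof -
      have "w $ k \<in> {a..<c $ k + 2 ^ j * ((y $ k - c $ k) div 2 ^ j + 1)}"
        using that unfolding dyadic_box_as_product a_def by blast
      then show ?thesis by (simp add: a_def distrib_left)
    qed
    from this[OF assms(1)] this[OF assms(2)] show ?thesis by auto
  qed
  then have "real_of_int \<bar>u $ k - v $ k\<bar> \<le> 2 ^ j" for k
    by (metis of_int_le_iff of_int_numeral of_int_power)
  then have "norm1 (u - v) \<le> (\<Sum>k\<in>(UNIV :: 'd set). 2 ^ j)"
    unfolding norm1_def by (intro sum_mono) auto
  also have "\<dots> \<le> 2 ^ CARD('d) * 2 ^ j"
    using of_nat_less_two_power[of "CARD('d)", where ?'a=real] by (simp add: mult_right_mono less_imp_le)
  finally show ?thesis by (simp add: power_add mult.commute)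
qed

lemma abs_le_norm1: "real_of_int \<bar>x $ k\<bar> \<le> norm1 x"
  unfolding norm1_def by (rule member_le_sum) auto

lemma in_dyadic_box_0:
  assumes "norm1 x < 2 ^ j"
  shows "x \<in> dyadic_box (\<chi> k. min 0 (x $ k)) j 0"
proof -
  have "real_of_int \<bar>x $ k\<bar> < real_of_int (2 ^ j)" for k
    using abs_le_norm1[of x k] assms by simp
  then have "\<bar>x $ k\<bar> < 2 ^ j" for k by (simp only: of_int_less_iff)
  then have *: "x $ k < 2 ^ j" "- x $ k < 2 ^ j" for k by (auto simp: abs_less_iff)
  have "(x $ k - min 0 (x $ k)) div 2 ^ j = 0" "(0 - min 0 (x $ k)) div 2 ^ j = 0" for k
    using *[of k] by (intro div_pos_pos_trivial; simp add: min_def)+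
  then show ?thesis by (simp add: dyadic_box_def)
qed

subsection \<open>Exponential moments of passage times inside boxes\<close>

text \<open>Tilting the density of rate l by exp(a x) gives l / (l - a) times the density of rate l
  - a. Positive \<open>a\<close> serves the cheapest crossing edge, negative \<open>a\<close> the
  Laplace transform of a single edge in the lower tail.\<close>

lemma (in prob_space) exponential_exp_moment:
  assumes X: "distributed M lborel X (exponential_density l)" and l: "0 < l" and a: "a < l"
  shows "(\<integral>\<^sup>+ s. ennreal (exp (a * max 0 (X s))) \<partial>M) = ennreal (l / (l - a))"
proof -
  interpret D: prob_space "density lborel (exponential_density (l - a))"
    using a by (intro prob_space_exponential_density) auto
  have one: "(\<integral>\<^sup>+ x. ennreal (exponential_density (l - a) x) \<partial>lborel) = 1"
    using D.emeasure_space_1 by (simp add: emeasure_density)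
  have "(\<integral>\<^sup>+ s. ennreal (exp (a * max 0 (X s))) \<partial>M)
      = (\<integral>\<^sup>+ x. ennreal (exponential_density l x) * ennreal (exp (a * max 0 x)) \<partial>lborel)"
    by (rule distributed_nn_integral[OF X, symmetric]) measurable
  also have "\<dots> = (\<integral>\<^sup>+ x. ennreal (l / (l - a)) * ennreal (exponential_density (l - a) x) \<partial>lborel)"
  proof (rule nn_integral_cong)
    fix x :: real
    have "exponential_density l x * exp (a * max 0 x) = l / (l - a) * exponential_density (l - a) x"
    proof (cases "x < 0")
      case False
      then have "exp (- x * l) * exp (a * max 0 x) = exp (- x * (l - a))"
        by (simp add: exp_add[symmetric] algebra_simps)
      then show ?thesis using False a by (simp add: exponential_density_def)
    qed (simp add: exponential_density_def)
    then show "ennreal (exponential_density l x) * ennreal (exp (a * max 0 x))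
        = ennreal (l / (l - a)) * ennreal (exponential_density (l - a) x)"
      using l a by (simp add: ennreal_mult'[symmetric] ennreal_mult''[symmetric] exponential_density_nonneg)
  qed
  also have "\<dots> = ennreal (l / (l - a))"
    by (simp add: nn_integral_cmult one)
  finally show ?thesis .
qed

text \<open>Each factor takes a full configuration but ignores coordinates outside its block, so
  passage times in different sets can be multiplied without restricting configurations
  explicitly.\<close>

lemma (in prob_space) indep_vars_nn_integral_3:
  fixes f g h :: "('i \<Rightarrow> real) \<Rightarrow> ennreal"
  assumes ind: "indep_vars (\<lambda>_. borel) X I"
    and K: "K1 \<subseteq> I" "K2 \<subseteq> I" "K3 \<subseteq> I" "K1 \<inter> K2 = {}" "K1 \<inter> K3 = {}" "K2 \<inter> K3 = {}"
    and f: "f \<in> borel_measurable (PiM K1 (\<lambda>_. borel))" "\<And>w. f (restrict w K1) = f w"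
    and g: "g \<in> borel_measurable (PiM K2 (\<lambda>_. borel))" "\<And>w. g (restrict w K2) = g w"
    and h: "h \<in> borel_measurable (PiM K3 (\<lambda>_. borel))" "\<And>w. h (restrict w K3) = h w"
  shows "(\<integral>\<^sup>+ s. f (\<lambda>i. X i s) * g (\<lambda>i. X i s) * h (\<lambda>i. X i s) \<partial>M)
    = (\<integral>\<^sup>+ s. f (\<lambda>i. X i s) \<partial>M) * (\<integral>\<^sup>+ s. g (\<lambda>i. X i s) \<partial>M) * (\<integral>\<^sup>+ s. h (\<lambda>i. X i s) \<partial>M)"
proof -
  define K where "K j = (if j = 0 then K1 else if j = 1 then K2 else K3)" for j :: nat
  define Y where "Y j = (if j = 0 then f else if j = 1 then g else h)" for j :: nat
  have "indep_vars (\<lambda>j. PiM (K j) (\<lambda>_. borel)) (\<lambda>j s. restrict (\<lambda>i. X i s) (K j)) {..<3}"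
    using K by (intro indep_vars_restrict[OF ind]) (auto simp: K_def disjoint_family_on_def)
  then have "indep_vars (\<lambda>_. borel) (\<lambda>j s. Y j (restrict (\<lambda>i. X i s) (K j))) {..<3}"
    by (rule indep_vars_compose2) (auto simp: K_def Y_def f g h)
  from indep_vars_nn_integral[OF _ this] show ?thesis
    by (simp add: eval_nat_numeral Y_def K_def f g h mult.assoc)
qed

section \<open>The model, and joining two disjoint sets by their cheapest crossing edge\<close>

locale long_range_fpp = prob_space M for M :: "'a measure" +
  fixes \<omega> :: "(int ^ 'd) set \<Rightarrow> 'a \<Rightarrow> real" and L :: "real \<Rightarrow> real"
  assumes indep: "indep_vars (\<lambda>_. borel) \<omega> edges"
    and expo: "\<And>e. e \<in> edges \<Longrightarrow> distributed M lborel (\<omega> e) (exponential_density 1)"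
    and SV: "slowly_varying L"
    and rate_antimono: "\<And>k m::nat. 1 \<le> k \<Longrightarrow> k \<le> m \<Longrightarrow> rate CARD('d) L (real m) \<le> rate CARD('d) L (real k)"
begin

lemma omega_measurable: "e \<in> edges \<Longrightarrow> \<omega> e \<in> borel_measurable M"
  using indep by (auto simp: indep_vars_def)

lemma rate_ge_dyadic:
  assumes "(u :: int ^ 'd) \<noteq> v" "norm1 (u - v) \<le> 2 ^ m"
  shows "rate CARD('d) L (2 ^ m) \<le> rate CARD('d) L (norm1 (u - v))"
proof -
  obtain n where n: "norm1 (u - v) = real n" using norm1_eq_of_nat by blast
  have "1 \<le> n" using norm1_ge_1[of "u - v"] assms(1) n by simp
  moreover have "real n \<le> real (2 ^ m)" using assms(2) n by simp
  then have "n \<le> 2 ^ m" by (simp only: of_nat_le_iff)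
  ultimately show ?thesis using rate_antimono[of n "2 ^ m"] n by simp
qed

lemma rate_dyadic: "rate CARD('d) L (2 ^ m) = L (2 ^ m) / 2 ^ (m * CARD('d))"
  by (simp add: rate_def powr_minus powr_realpow power_mult divide_inverse mult.commute)

lemma dist_in_omega_measurable [measurable]:
  "(\<lambda>s. dist_in L Q (\<lambda>e. \<omega> e s) x y) \<in> borel_measurable M"
proof -
  have "(\<lambda>s. \<lambda>e\<in>edges_in Q. \<omega> e s) \<in> measurable M (PiM (edges_in Q) (\<lambda>_. borel))"
    by (intro measurable_restrict omega_measurable) (auto simp: edges_in_def)
  from measurable_comp[OF this dist_in_measurable[of L Q x y]]
  have "(\<lambda>s. dist_in L Q (\<lambda>e\<in>edges_in Q. \<omega> e s) x y) \<in> borel_measurable M" by (simp add: comp_def)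
  moreover have "dist_in L Q (\<lambda>e\<in>edges_in Q. \<omega> e s) x y = dist_in L Q (\<lambda>e. \<omega> e s) x y" for s
    by (rule dist_in_cong) simp
  ultimately show ?thesis by simp
qed

text \<open>The cheapest edge joining two disjoint sets is chosen using crossing edges only, hence
  independently of the passage times inside the two sets.\<close>

lemma exp_moment_crossing:
  assumes fin: "finite A" "finite B" and disj: "A \<inter> B = {}" and sub: "A \<subseteq> Q" "B \<subseteq> Q"
    and x: "x \<in> A" and y: "y \<in> B"
    and rho: "0 < \<rho>" "\<And>u v. u \<in> A \<Longrightarrow> v \<in> B \<Longrightarrow> \<rho> \<le> rate CARD('d) L (norm1 (u - v))"
    and th: "0 \<le> \<theta>" "\<theta> \<le> \<rho> * real (card A * card B) / 2"
    and Ka: "\<And>u. u \<in> A \<Longrightarrow> (\<integral>\<^sup>+ s. ennreal (exp (\<theta> * dist_in L A (\<lambda>e. \<omega> e s) x u)) \<partial>M) \<le> Ka"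
    and Kb: "\<And>v. v \<in> B \<Longrightarrow> (\<integral>\<^sup>+ s. ennreal (exp (\<theta> * dist_in L B (\<lambda>e. \<omega> e s) v y)) \<partial>M) \<le> Kb"
  shows "(\<integral>\<^sup>+ s. ennreal (exp (\<theta> * dist_in L Q (\<lambda>e. \<omega> e s) x y)) \<partial>M) \<le> 2 * Ka * Kb"
proof -
  define N where "N = card A * card B"
  have N0: "0 < N" using fin x y unfolding N_def by (auto simp: card_gt_0_iff)
  obtain f where f: "bij_betw f {0..<N} (A \<times> B)"
    using ex_bij_betw_nat_finite[of "A \<times> B"] fin unfolding N_def by (auto simp: card_cartesian_product)
  define E where "E k = {fst (f k), snd (f k)}" for k
  have fk: "fst (f k) \<in> A" "snd (f k) \<in> B" "fst (f k) \<noteq> snd (f k)" if "k < N" for k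
  proof -
    have "f k \<in> A \<times> B" by (rule bij_betwE[OF f, rule_format]) (use that in simp)
    then show "fst (f k) \<in> A" "snd (f k) \<in> B" "fst (f k) \<noteq> snd (f k)" using disj by auto
  qed
  have Eedge: "E k \<in> edges" if "k < N" for k
    unfolding E_def by (intro edge_in_edges fk that)
  have injE: "inj_on E {..<N}"
  proof (rule inj_onI)
    fix k l assume kl: "k \<in> {..<N}" "l \<in> {..<N}" "E k = E l"
    then have "fst (f k) = fst (f l)" "snd (f k) = snd (f l)"
      using fk[of k] fk[of l] disj by (auto simp: E_def doubleton_eq_iff)
    then have "f k = f l" by (simp add: prod_eq_iff)
    then show "k = l" using f kl unfolding bij_betw_def by (auto dest: inj_onD)
  qed
  \<comment> \<open>Ties go to the smallest index, so exactly one crossing edge is selected in every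
    configuration and the sum over k below has a single nonzero term, with no exceptional null
    set.\<close>
  define sel where "sel k w \<longleftrightarrow> (\<forall>l<N. w (E k) \<le> w (E l)) \<and> (\<forall>l<k. w (E k) < w (E l))" for k and w :: "(int ^ 'd) set \<Rightarrow> real"
  define F where "F k w = (if sel k w then ennreal (exp (\<theta> / \<rho> * max 0 (w (E k)))) else 0)" for k and w :: "(int ^ 'd) set \<Rightarrow> real"
  have sel_ex: "\<exists>k<N. sel k w" for w
  proof -
    define m where "m = Min ((\<lambda>k. w (E k)) ` {..<N})"
    have "m \<in> (\<lambda>k. w (E k)) ` {..<N}" unfolding m_def using N0 by (intro Min_in) auto
    then have ex: "\<exists>k. k < N \<and> w (E k) = m" by auto
    define k where "k = (LEAST k. k < N \<and> w (E k) = m)"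
    have k: "k < N" "w (E k) = m" using LeastI_ex[OF ex] unfolding k_def by auto
    have le: "m \<le> w (E l)" if "l < N" for l unfolding m_def using that by (intro Min_le) auto
    have "m < w (E l)" if "l < k" for l
    proof -
      have "w (E l) \<noteq> m"
        using not_less_Least[of l "\<lambda>k. k < N \<and> w (E k) = m"] that k(1) unfolding k_def by auto
      then show ?thesis using le[of l] that k(1) by simp
    qed
    then have "sel k w" unfolding sel_def using k le by auto
    then show ?thesis using k by blast
  qed
  have sel_unique: "k = l" if "sel k w" "sel l w" "k < N" "l < N" for k l w
    using that unfolding sel_def by (metis linorder_neqE_nat not_less)
  have point: "ennreal (exp (\<theta> * dist_in L Q w x y))
      \<le> (\<Sum>k<N. F k w * ennreal (exp (\<theta> * dist_in L A w x (fst (f k)))) * ennreal (exp (\<theta> * dist_in L B w (snd (f k)) y)))" for w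
  proof -
    obtain k where k: "k < N" "sel k w" using sel_ex by blast
    have "dist_in L Q w x y \<le> dist_in L A w x (fst (f k)) + cost L w (fst (f k)) (snd (f k)) + dist_in L B w (snd (f k)) y"
      using fk[OF k(1)] by (intro dist_in_crossing SV sub x y)
    moreover have "cost L w (fst (f k)) (snd (f k)) \<le> max 0 (w (E k)) / \<rho>"
      unfolding cost_def E_def using rho fk[OF k(1)] by (intro divide_left_mono mult_pos_pos) (auto intro: order.strict_trans2)
    ultimately have "\<theta> * dist_in L Q w x y \<le> \<theta> * (max 0 (w (E k)) / \<rho> + dist_in L A w x (fst (f k)) + dist_in L B w (snd (f k)) y)"
      using th by (intro mult_left_mono) auto
    then have "exp (\<theta> * dist_in L Q w x y) \<le> exp (\<theta> / \<rho> * max 0 (w (E k))) * exp (\<theta> * dist_in L A w x (fst (f k))) * exp (\<theta> * dist_in L B w (snd (f k)) y)"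
      by (simp add: exp_add[symmetric] distrib_left)
    then have "ennreal (exp (\<theta> * dist_in L Q w x y)) \<le> F k w * ennreal (exp (\<theta> * dist_in L A w x (fst (f k)))) * ennreal (exp (\<theta> * dist_in L B w (snd (f k)) y))"
      using k by (simp add: F_def ennreal_mult[symmetric] ennreal_leI)
    also have "\<dots> \<le> (\<Sum>k<N. F k w * ennreal (exp (\<theta> * dist_in L A w x (fst (f k)))) * ennreal (exp (\<theta> * dist_in L B w (snd (f k)) y)))"
      using k by (intro member_le_sum) auto
    finally show ?thesis .
  qed
  define C where "C = E ` {..<N}"
  have F_meas: "F k \<in> borel_measurable (PiM C (\<lambda>_. borel))" if "k < N" for k
  proof -
    have c[measurable]: "(\<lambda>w. w (E l) :: real) \<in> borel_measurable (PiM C (\<lambda>_. borel))" if "l < N" for l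
      by (rule measurable_component_singleton) (use that in \<open>auto simp: C_def\<close>)
    note [measurable] = c[OF that]
    have sets: "{w \<in> space (PiM C (\<lambda>_. borel)). sel k w} \<in> sets (PiM C (\<lambda>_. borel))"
    proof -
      have 1: "{w \<in> space (PiM C (\<lambda>_. borel :: real measure)). \<forall>l\<in>{..<N}. w (E k) \<le> w (E l)} \<in> sets (PiM C (\<lambda>_. borel))"
        by (intro sets.sets_Collect_finite_All) (auto intro: borel_measurable_le[OF c[OF that] c])
      have 2: "{w \<in> space (PiM C (\<lambda>_. borel :: real measure)). \<forall>l\<in>{..<k}. w (E k) < w (E l)} \<in> sets (PiM C (\<lambda>_. borel))"
        using that by (intro sets.sets_Collect_finite_All) (auto intro: borel_measurable_less[OF c[OF that] c])
      from sets.sets_Collect_conj[OF 2 1] show ?thesis by (simp only: sel_def Ball_def lessThan_iff)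
    qed
    show ?thesis unfolding F_def
      by (rule measurable_If[OF _ _ sets]) measurable
  qed
  have F_restrict: "F k (restrict w C) = F k w" if "k < N" for k w
    using that unfolding F_def sel_def C_def by auto
  have CA: "C \<subseteq> edges" "edges_in A \<subseteq> edges" "edges_in B \<subseteq> edges"
    using Eedge by (auto simp: C_def edges_in_def)
  have E_not: "\<not> E k \<subseteq> A" "\<not> E k \<subseteq> B" if "k < N" for k
    using fk[OF that] disj unfolding E_def by auto
  have dC: "C \<inter> edges_in A = {}" "C \<inter> edges_in B = {}"
    using E_not unfolding C_def edges_in_def by auto
  have dAB: "edges_in A \<inter> edges_in B = {}"
  proof -
    have False if "e \<in> edges" "e \<subseteq> A" "e \<subseteq> B" for e
    proof -
      have "e \<noteq> {}" using that(1) by (auto simp: edges_def)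
      then show False using that disj by blast
    qed
    then show ?thesis unfolding edges_in_def by auto
  qed
  note [measurable] = dist_in_measurable
  \<comment> \<open>Whether edge k is selected depends on all crossing edges, so \<open>F k\<close>
    is assigned the whole block \<open>C\<close>. The end points of the selected edge are random,
    which is why \<open>Ka\<close> and \<open>Kb\<close> must bound the moments for every choice of
    them.\<close>
  have factor: "(\<integral>\<^sup>+ s. F k (\<lambda>e. \<omega> e s) * ennreal (exp (\<theta> * dist_in L A (\<lambda>e. \<omega> e s) x (fst (f k))))
        * ennreal (exp (\<theta> * dist_in L B (\<lambda>e. \<omega> e s) (snd (f k)) y)) \<partial>M)
      \<le> (\<integral>\<^sup>+ s. F k (\<lambda>e. \<omega> e s) \<partial>M) * Ka * Kb" if k: "k < N" for k
  proof -
    have "(\<integral>\<^sup>+ s. F k (\<lambda>e. \<omega> e s) * ennreal (exp (\<theta> * dist_in L A (\<lambda>e. \<omega> e s) x (fst (f k))))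
        * ennreal (exp (\<theta> * dist_in L B (\<lambda>e. \<omega> e s) (snd (f k)) y)) \<partial>M)
      = (\<integral>\<^sup>+ s. F k (\<lambda>e. \<omega> e s) \<partial>M) *
        (\<integral>\<^sup>+ s. ennreal (exp (\<theta> * dist_in L A (\<lambda>e. \<omega> e s) x (fst (f k)))) \<partial>M) *
        (\<integral>\<^sup>+ s. ennreal (exp (\<theta> * dist_in L B (\<lambda>e. \<omega> e s) (snd (f k)) y)) \<partial>M)"
    proof (rule indep_vars_nn_integral_3[OF indep CA dC dAB F_meas[OF k] F_restrict[OF k]])
      show "(\<lambda>w. ennreal (exp (\<theta> * dist_in L A w x (fst (f k))))) \<in> borel_measurable (PiM (edges_in A) (\<lambda>_. borel))"
        "(\<lambda>w. ennreal (exp (\<theta> * dist_in L B w (snd (f k)) y))) \<in> borel_measurable (PiM (edges_in B) (\<lambda>_. borel))"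
        by measurable
      show "ennreal (exp (\<theta> * dist_in L A (restrict w (edges_in A)) x (fst (f k)))) = ennreal (exp (\<theta> * dist_in L A w x (fst (f k))))" for w
        by (subst dist_in_cong[of A _ w]) auto
      show "ennreal (exp (\<theta> * dist_in L B (restrict w (edges_in B)) (snd (f k)) y)) = ennreal (exp (\<theta> * dist_in L B w (snd (f k)) y))" for w
        by (subst dist_in_cong[of B _ w]) auto
    qed
    also have "\<dots> \<le> (\<integral>\<^sup>+ s. F k (\<lambda>e. \<omega> e s) \<partial>M) * Ka * Kb"
      using fk[OF k] by (intro mult_mono order_refl Ka Kb) auto
    finally show ?thesis .
  qed
  have F_omega [measurable]: "(\<lambda>s. F k (\<lambda>e. \<omega> e s)) \<in> borel_measurable M" if "k < N" for k
  proof -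
    have "(\<lambda>s. \<lambda>e\<in>C. \<omega> e s) \<in> measurable M (PiM C (\<lambda>_. borel))"
      using CA by (intro measurable_restrict omega_measurable) auto
    from measurable_comp[OF this F_meas[OF that]] show ?thesis
      using F_restrict[OF that] by (simp add: comp_def)
  qed
  \<comment> \<open>Summed over k, the selected terms give the exponential moment of the minimum of
    N unit exponentials, an exponential variable of rate N. This moment is N / (N -
    \<theta>/\<rho>), at most 2 since \<theta>/\<rho> <= N/2.\<close>
  have total: "(\<Sum>k<N. \<integral>\<^sup>+ s. F k (\<lambda>e. \<omega> e s) \<partial>M) \<le> 2"
  proof -
    have half: "\<theta> / \<rho> \<le> real N / 2"
      using th rho(1) unfolding N_def[symmetric] by (simp add: field_simps)
    have ind: "indep_vars (\<lambda>_. borel) \<omega> C" by (rule indep_vars_subset[OF indep CA(1)])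
    have Cn: "finite C" "C \<noteq> {}" "card C = N" using N0 card_image[OF injE] by (auto simp: C_def)
    have D: "distributed M lborel (\<lambda>s. Min ((\<lambda>e. \<omega> e s) ` C)) (exponential_density (real N))"
      using exponential_distributed_Min[OF Cn(1,2) _ _ ind, of "\<lambda>_. 1"] expo CA(1) Cn(3) by auto
    have "(\<Sum>k<N. \<integral>\<^sup>+ s. F k (\<lambda>e. \<omega> e s) \<partial>M) = (\<integral>\<^sup>+ s. (\<Sum>k<N. F k (\<lambda>e. \<omega> e s)) \<partial>M)"
      by (intro nn_integral_sum[symmetric]) auto
    also have "\<dots> \<le> (\<integral>\<^sup>+ s. ennreal (exp (\<theta> / \<rho> * max 0 (Min ((\<lambda>e. \<omega> e s) ` C)))) \<partial>M)"
    proof (rule nn_integral_mono)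
      fix s
      let ?w = "\<lambda>e. \<omega> e s"
      obtain k where k: "k < N" "sel k ?w" using sel_ex by blast
      have "F l ?w = 0" if "l \<in> {..<N} - {k}" for l
        using sel_unique[OF _ k(2) _ k(1), of l] that by (auto simp: F_def)
      then have "(\<Sum>l<N. F l ?w) = (\<Sum>l\<in>{k}. F l ?w)"
        using k(1) by (intro sum.mono_neutral_right) auto
      also have "\<dots> = ennreal (exp (\<theta> / \<rho> * max 0 (?w (E k))))" using k by (simp add: F_def)
      also have "?w (E k) = Min (?w ` C)"
        using k by (intro Min_eqI[symmetric]) (auto simp: C_def sel_def)
      finally show "(\<Sum>l<N. F l ?w) \<le> ennreal (exp (\<theta> / \<rho> * max 0 (Min (?w ` C))))" by simp
    qed
    also have "\<dots> = ennreal (real N / (real N - \<theta> / \<rho>))"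
    proof (rule exponential_exp_moment[OF D])
      show "0 < real N" using N0 by simp
      then show "\<theta> / \<rho> < real N" using half by linarith
    qed
    also have "\<dots> \<le> ennreal 2"
    proof (rule ennreal_leI)
      have "0 < real N" using N0 by simp
      moreover have "0 < n - t \<and> n \<le> 2 * (n - t)" if "0 < n" "t \<le> n / 2" for n t :: real
        using that by auto
      ultimately have "0 < real N - \<theta> / \<rho>" "real N \<le> 2 * (real N - \<theta> / \<rho>)" using half by blast+
      then show "real N / (real N - \<theta> / \<rho>) \<le> 2" by (simp only: pos_divide_le_eq)
    qed
    finally show ?thesis by simp
  qed
  have "(\<integral>\<^sup>+ s. ennreal (exp (\<theta> * dist_in L Q (\<lambda>e. \<omega> e s) x y)) \<partial>M)
      \<le> (\<integral>\<^sup>+ s. (\<Sum>k<N. F k (\<lambda>e. \<omega> e s) * ennreal (exp (\<theta> * dist_in L A (\<lambda>e. \<omega> e s) x (fst (f k))))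
        * ennreal (exp (\<theta> * dist_in L B (\<lambda>e. \<omega> e s) (snd (f k)) y))) \<partial>M)"
    by (intro nn_integral_mono point)
  also have "\<dots> = (\<Sum>k<N. \<integral>\<^sup>+ s. F k (\<lambda>e. \<omega> e s) * ennreal (exp (\<theta> * dist_in L A (\<lambda>e. \<omega> e s) x (fst (f k))))
        * ennreal (exp (\<theta> * dist_in L B (\<lambda>e. \<omega> e s) (snd (f k)) y)) \<partial>M)"
    by (intro nn_integral_sum borel_measurable_times_ennreal F_omega) auto
  also have "\<dots> \<le> (\<Sum>k<N. (\<integral>\<^sup>+ s. F k (\<lambda>e. \<omega> e s) \<partial>M) * Ka * Kb)"
    by (intro sum_mono factor) auto
  also have "\<dots> = (\<Sum>k<N. \<integral>\<^sup>+ s. F k (\<lambda>e. \<omega> e s) \<partial>M) * Ka * Kb"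
    by (simp add: sum_distrib_right)
  also have "\<dots> \<le> 2 * Ka * Kb" by (intro mult_right_mono total) auto
  finally show ?thesis .
qed

end

section \<open>How much larger than j the two sub-scales must add up to\<close>

lemma exists_scale_loss:
  assumes SV: "slowly_varying L" and d: "1 \<le> d"
    and int2: "(\<integral>\<^sup>+ x \<in> {1<..}. ennreal (- ln (L x) / (x * (ln x)\<^sup>2)) \<partial>lborel) < \<infinity>"
  shows "\<exists>B. (\<forall>j. 1 \<le> B j) \<and> summable (\<lambda>j. real (B j) / (real j)\<^sup>2) \<and>
    eventually (\<lambda>j. 8 * B j \<le> j) sequentially \<and>
    (\<forall>i j. j + B j \<le> i \<longrightarrow> 1 \<le> 2 ^ (i * d) * (L (2 ^ (j + d)) / 2 ^ ((j + d) * d)))"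
proof -
  have pos: "0 < L (2 ^ j)" for j :: nat using SV by (auto simp: slowly_varying_def)
  define h where "h j = max 0 (- ln (L (2 ^ j)))" for j :: nat
  have h0: "0 \<le> h j" for j by (simp add: h_def)
  define n where "n j = nat \<lceil>h (j + d)\<rceil>" for j
  have n1: "h (j + d) \<le> real (n j)" for j unfolding n_def by linarith
  have n2: "real (n j) \<le> h (j + d) + 1" for j using h0[of "j + d"] unfolding n_def by linarith
  \<comment> \<open>The summand d makes up for the diameter 2^(j+d) of the box, at which the rate is
    evaluated. The summand 2 n j compensates the smallness of L there: 1 / L <= e^n <= 4^n =
    2^(2n).\<close>
  define B where "B j = d + 2 * n j" for j
  have sh: "summable (\<lambda>j. h j / (real j)\<^sup>2)"
    using summable_neg_ln_L_dyadic[OF SV int2] by (simp add: h_def)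
  have s1: "summable (\<lambda>j. h (j + d) / (real (j + d))\<^sup>2)"
    using summable_iff_shift[of "\<lambda>j. h j / (real j)\<^sup>2" d] sh by simp
  have s2: "summable (\<lambda>j. 1 / (real j)\<^sup>2)"
    using inverse_power_summable[of 2, where ?'a=real] by (simp add: inverse_eq_divide)
  have summB: "summable (\<lambda>j. real (B j) / (real j)\<^sup>2)"
  proof (rule summable_comparison_test'[where N=1 and
        g="\<lambda>j. (real d + 2) * (1 / (real j)\<^sup>2) + 2 * (real d + 1)\<^sup>2 * (h (j + d) / (real (j + d))\<^sup>2)"])
    show "summable (\<lambda>j. (real d + 2) * (1 / (real j)\<^sup>2) + 2 * (real d + 1)\<^sup>2 * (h (j + d) / (real (j + d))\<^sup>2))"
      by (intro summable_add summable_mult s1 s2)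
    fix j :: nat assume j: "1 \<le> j"
    have "real d * 1 \<le> real d * real j" using j by (intro mult_left_mono) auto
    then have "real (j + d) \<le> (real d + 1) * real j" by (simp add: algebra_simps)
    then have "(real (j + d))\<^sup>2 \<le> ((real d + 1) * real j)\<^sup>2" by (intro power_mono) auto
    then have "(real (j + d))\<^sup>2 \<le> (real d + 1)\<^sup>2 * (real j)\<^sup>2" by (simp add: power_mult_distrib)
    then have "h (j + d) * (real (j + d))\<^sup>2 \<le> h (j + d) * ((real d + 1)\<^sup>2 * (real j)\<^sup>2)"
      by (intro mult_left_mono h0)
    then have 1: "h (j + d) / (real j)\<^sup>2 \<le> (real d + 1)\<^sup>2 * (h (j + d) / (real (j + d))\<^sup>2)"
      using j d by (simp add: divide_simps mult_ac)
    have "real (B j) \<le> real d + 2 + 2 * h (j + d)" unfolding B_def using n2[of j] by simp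
    then have "real (B j) / (real j)\<^sup>2 \<le> (real d + 2 + 2 * h (j + d)) / (real j)\<^sup>2"
      by (intro divide_right_mono) auto
    also have "\<dots> = (real d + 2) * (1 / (real j)\<^sup>2) + 2 * (h (j + d) / (real j)\<^sup>2)"
      by (simp add: add_divide_distrib)
    finally show "norm (real (B j) / (real j)\<^sup>2)
        \<le> (real d + 2) * (1 / (real j)\<^sup>2) + 2 * (real d + 1)\<^sup>2 * (h (j + d) / (real (j + d))\<^sup>2)"
      using 1 by simp
  qed
  \<comment> \<open>Any small slope would do: B contains 2 h and is multiplied by 8, so 1/64 costs a
    quarter of j and leaves room for the constants.\<close>
  have "eventually (\<lambda>j. - ln (L (2 ^ j)) \<le> 1/64 * real j) sequentially"
    by (rule neg_ln_L_dyadic_sublinear[OF SV]) simp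
  then have "eventually (\<lambda>j. - ln (L (2 ^ (j + d))) \<le> 1/64 * real (j + d)) sequentially"
    by (rule sequentially_offset)
  then have small: "eventually (\<lambda>j. 8 * B j \<le> j) sequentially"
    using eventually_ge_at_top[of "32 * d + 64"]
  proof eventually_elim
    case (elim j)
    have "h (j + d) \<le> real (j + d) / 64" using elim unfolding h_def by simp
    then have "real (8 * B j) \<le> real j" using n2[of j] elim(2) unfolding B_def by simp
    then show ?case by (simp only: of_nat_le_iff)
  qed
  have "1 \<le> 2 ^ (i * d) * (L (2 ^ (j + d)) / 2 ^ ((j + d) * d))" if "j + B j \<le> i" for i j
  proof -
    have "1 / L (2 ^ (j + d)) = exp (- ln (L (2 ^ (j + d))))"
      using pos[of "j + d"] by (simp add: exp_minus divide_inverse)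
    also have "\<dots> \<le> exp (real (n j))" using n1[of j] unfolding h_def by simp
    also have "\<dots> = exp 1 ^ n j" by (simp add: exp_of_nat_mult[symmetric])
    also have "\<dots> \<le> 4 ^ n j" using exp_le by (intro power_mono) auto
    also have "\<dots> = 2 ^ (2 * n j)" by (simp add: power_mult)
    also have "\<dots> \<le> 2 ^ (2 * n j * d)" using d by (intro power_increasing) auto
    finally have 1: "1 \<le> 2 ^ (2 * n j * d) * L (2 ^ (j + d))"
      using pos[of "j + d"] by (simp add: field_simps)
    have "(2::real) ^ (2 * n j * d) * 2 ^ ((j + d) * d) = 2 ^ ((j + B j) * d)"
      unfolding B_def by (simp add: power_add[symmetric] algebra_simps)
    also have "\<dots> \<le> 2 ^ (i * d)" using that by (intro power_increasing mult_right_mono) auto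
    finally have 2: "2 ^ (2 * n j * d) * 2 ^ ((j + d) * d) * L (2 ^ (j + d)) \<le> 2 ^ (i * d) * L (2 ^ (j + d))"
      using pos[of "j + d"] by (intro mult_right_mono) auto
    have 3: "P \<le> R * l" if "1 \<le> Q * l" "0 \<le> P" "Q * P * l \<le> R * l" for P Q R l :: real
      using mult_left_mono[OF that(1,2)] that(3) by (simp add: mult_ac)
    have "2 ^ ((j + d) * d) \<le> 2 ^ (i * d) * L (2 ^ (j + d))" by (rule 3[OF 1 _ 2]) simp
    then show ?thesis by (simp add: le_divide_eq)
  qed
  moreover have "1 \<le> B j" for j using d by (simp add: B_def)
  ultimately show ?thesis using summB small by (intro exI[of _ B]) blast
qed

section \<open>Induction over scales and the upper tail\<close>

context long_range_fpp
begin

lemma exp_moment_dyadic_box: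
  assumes int2: "(\<integral>\<^sup>+ x \<in> {1<..}. ennreal (- ln (L x) / (x * (ln x)\<^sup>2)) \<partial>lborel) < \<infinity>"
  shows "\<exists>\<theta>>0. \<exists>C>0. \<forall>c j x y. y \<in> dyadic_box c j x \<longrightarrow>
    (\<integral>\<^sup>+ s. ennreal (exp (\<theta> * dist_in L (dyadic_box c j x) (\<lambda>e. \<omega> e s) x y)) \<partial>M) \<le> ennreal (exp (C * (real j + 1)))"
proof -
  let ?d = "CARD('d)"
  obtain B where B1: "\<And>j. 1 \<le> B j" and B2: "summable (\<lambda>j. real (B j) / (real j)\<^sup>2)"
    and B3: "eventually (\<lambda>j. 8 * B j \<le> j) sequentially"
    and B4: "\<And>i j. j + B j \<le> i \<Longrightarrow> 1 \<le> 2 ^ (i * ?d) * (L (2 ^ (j + ?d)) / 2 ^ ((j + ?d) * ?d))"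
    using exists_scale_loss[OF SV _ int2, of ?d] by auto
  obtain g :: "nat \<Rightarrow> real" and j0 C where C: "0 < C" and gC: "\<And>j. g j \<le> C * (real j + 1)" and g1: "\<And>j. 1 \<le> g j"
    and split: "\<And>j. j0 < j \<Longrightarrow> \<exists>i i'. i' \<le> i \<and> i < j \<and> j + B j \<le> i + i' \<and> g i + g i' \<le> g j"
    using exists_scale_splitting[OF B1 B2 B3] by blast
  define \<rho>0 where "\<rho>0 = rate ?d L (2 ^ (j0 + ?d))"
  have \<rho>0: "0 < \<rho>0" unfolding \<rho>0_def by (intro rate_pos SV) simp
  \<comment> \<open>The bound 1/2 serves the splits, where rate times number of crossing edges is at
    least 1; the bound \<rho>0 / 2 serves the scales up to \<open>j0\<close>, where the direct edge
    is used and its rate is at least \<rho>0.\<close>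
  define \<theta> where "\<theta> = min (1/2) (\<rho>0 / 2)"
  have th: "0 < \<theta>" "\<theta> \<le> 1/2" "\<theta> \<le> \<rho>0 / 2" using \<rho>0 unfolding \<theta>_def by auto
  \<comment> \<open>Division by 2 absorbs the factor of a split: 2 * (exp(2 a)/2) * (exp(2 b)/2) =
    exp(2 (a + b))/2. Doubling g makes the base case fit: g >= 1 gives exp(2 g)/2 >= 2, which
    dominates the moment of the direct edge.\<close>
  have main: "(\<integral>\<^sup>+ s. ennreal (exp (\<theta> * dist_in L (dyadic_box c j x) (\<lambda>e. \<omega> e s) x y)) \<partial>M) \<le> ennreal (exp (2 * g j) / 2)"
    if "y \<in> dyadic_box c j x" for c j x y
    using that
  proof (induction j arbitrary: x y rule: less_induct)
    case (less j x y)
    let ?Q = "dyadic_box c j x"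
    show ?case
    proof (cases "j \<le> j0")
      case True
      have "exp 2 \<le> exp (2 * g j)" using g1[of j] by simp
      moreover have "(1 + 1 + 1\<^sup>2 / 2) * (1 + 1 + 1\<^sup>2 / 2) \<le> exp (1::real) * exp 1"
        by (intro mult_mono exp_lower_Taylor_quadratic) auto
      then have "4 \<le> exp (2::real)" by (simp flip: exp_add)
      ultimately have e4: "4 \<le> exp (2 * g j)" by linarith
      show ?thesis
      proof (cases "x = y")
        case True
        have "1 \<le> exp (2 * g j) / 2" using e4 by simp
        from ennreal_leI[OF this] show ?thesis using True by (simp add: dist_in_refl SV emeasure_space_1)
      next
        case False
        define t where "t = \<theta> / \<rho>0"
        have half: "t \<le> 1/2" using th \<rho>0 unfolding t_def by (simp add: divide_le_eq)
        have "norm1 (x - y) \<le> 2 ^ (j + ?d)" using less.prems by (intro norm1_le_in_dyadic_box[of _ c j x]) auto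
        also have "\<dots> \<le> 2 ^ (j0 + ?d)" using True by (intro power_increasing) auto
        finally have r: "\<rho>0 \<le> rate ?d L (norm1 (x - y))"
          unfolding \<rho>0_def by (intro rate_ge_dyadic False)
        have "(\<integral>\<^sup>+ s. ennreal (exp (\<theta> * dist_in L ?Q (\<lambda>e. \<omega> e s) x y)) \<partial>M)
            \<le> (\<integral>\<^sup>+ s. ennreal (exp (t * max 0 (\<omega> {x, y} s))) \<partial>M)"
        proof (intro nn_integral_mono ennreal_leI)
          fix s
          have "dist_in L ?Q (\<lambda>e. \<omega> e s) x y \<le> cost L (\<lambda>e. \<omega> e s) x y"
            using less.prems False by (intro dist_in_le_cost SV) auto
          also have "\<dots> \<le> max 0 (\<omega> {x, y} s) / \<rho>0"
            unfolding cost_def using r \<rho>0 by (intro divide_left_mono mult_pos_pos) auto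
          finally have "\<theta> * dist_in L ?Q (\<lambda>e. \<omega> e s) x y \<le> \<theta> * (max 0 (\<omega> {x, y} s) / \<rho>0)"
            using th by (intro mult_left_mono) auto
          then show "exp (\<theta> * dist_in L ?Q (\<lambda>e. \<omega> e s) x y) \<le> exp (t * max 0 (\<omega> {x, y} s))"
            by (simp add: t_def)
        qed
        also have "(\<integral>\<^sup>+ s. ennreal (exp (t * max 0 (\<omega> {x, y} s))) \<partial>M) = ennreal (1 / (1 - t))"
          using half by (intro exponential_exp_moment expo edge_in_edges False) auto
        also have "\<dots> \<le> ennreal (exp (2 * g j) / 2)"
        proof (rule ennreal_leI)
          have "1 / (1 - t) \<le> 2" using half by (simp add: pos_divide_le_eq)
          also have "\<dots> \<le> exp (2 * g j) / 2" using e4 by simp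
          finally show "1 / (1 - t) \<le> exp (2 * g j) / 2" .
        qed
        finally show ?thesis .
      qed
    next
      case False
      then obtain i i' where i: "i' \<le> i" "i < j" "j + B j \<le> i + i'" "g i + g i' \<le> g j" using split[of j] by auto
      let ?A = "dyadic_box c i x" and ?B = "dyadic_box c i' y"
      have AQ: "?A \<subseteq> ?Q" using i by (intro dyadic_box_mono) auto
      have "?B \<subseteq> dyadic_box c j y" using i by (intro dyadic_box_mono) auto
      then have BQ: "?B \<subseteq> ?Q" using dyadic_box_eq[OF less.prems] by simp
      show ?thesis
      proof (cases "y \<in> ?A")
        case True
        have "(\<integral>\<^sup>+ s. ennreal (exp (\<theta> * dist_in L ?Q (\<lambda>e. \<omega> e s) x y)) \<partial>M)
            \<le> (\<integral>\<^sup>+ s. ennreal (exp (\<theta> * dist_in L ?A (\<lambda>e. \<omega> e s) x y)) \<partial>M)"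
          using th True AQ
          by (intro nn_integral_mono ennreal_leI) (auto intro!: mult_left_mono dist_in_antimono SV)
        also have "\<dots> \<le> ennreal (exp (2 * g i) / 2)" using i True by (intro less.IH) auto
        also have "\<dots> \<le> ennreal (exp (2 * g j) / 2)"
          using i(4) g1[of i'] by (intro ennreal_leI divide_right_mono) auto
        finally show ?thesis .
      next
        case y: False
        \<comment> \<open>This is where i' <= i matters: by nesting, a common point would put the
          larger box around y, and hence y itself, into the box of x.\<close>
        have disj: "?A \<inter> ?B = {}"
        proof (rule ccontr)
          assume "?A \<inter> ?B \<noteq> {}"
          then obtain z where z: "z \<in> ?A" "z \<in> ?B" by blast
          then have "z \<in> dyadic_box c i y" using dyadic_box_mono[OF i(1), of c y] by auto
          then have "dyadic_box c i y = ?A" using dyadic_box_eq z(1) by metis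
          then show False using y self_in_dyadic_box by metis
        qed
        \<comment> \<open>All crossing edges stay inside the big box, so their rates are bounded
          below by the rate at its diameter. The choice of the loss makes this rate times the number
          of crossing edges at least 1.\<close>
        let ?\<rho> = "rate ?d L (2 ^ (j + ?d))"
        have \<rho>: "0 < ?\<rho>" by (intro rate_pos SV) simp
        have "(\<integral>\<^sup>+ s. ennreal (exp (\<theta> * dist_in L ?Q (\<lambda>e. \<omega> e s) x y)) \<partial>M)
            \<le> 2 * ennreal (exp (2 * g i) / 2) * ennreal (exp (2 * g i') / 2)"
        proof (rule exp_moment_crossing[OF finite_dyadic_box finite_dyadic_box disj AQ BQ _ _ \<rho>])
          fix u v assume uv: "u \<in> ?A" "v \<in> ?B"
          then have "u \<noteq> v" using disj by auto
          moreover have "norm1 (u - v) \<le> 2 ^ (j + ?d)"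
            using uv AQ BQ by (intro norm1_le_in_dyadic_box[of _ c j x]) auto
          ultimately show "?\<rho> \<le> rate ?d L (norm1 (u - v))" by (rule rate_ge_dyadic)
        next
          have "real (card ?A * card ?B) = 2 ^ ((i + i') * ?d)"
            by (simp add: card_dyadic_box power_add distrib_right)
          then have "1 \<le> ?\<rho> * real (card ?A * card ?B)"
            using B4[OF i(3)] unfolding rate_dyadic by (simp only: mult.commute)
          then show "\<theta> \<le> ?\<rho> * real (card ?A * card ?B) / 2" using th by simp
        next
          fix u assume "u \<in> ?A"
          then show "(\<integral>\<^sup>+ s. ennreal (exp (\<theta> * dist_in L ?A (\<lambda>e. \<omega> e s) x u)) \<partial>M) \<le> ennreal (exp (2 * g i) / 2)"
            using i by (intro less.IH) auto
        next
          fix v assume v: "v \<in> ?B"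
          \<comment> \<open>The induction hypothesis names a box by the starting point of the path,
            while this box is named by its end point y; every member names the same box.\<close>
          then have "?B = dyadic_box c i' v" by (simp add: dyadic_box_eq)
          then have "y \<in> dyadic_box c i' v" using self_in_dyadic_box by metis
          then show "(\<integral>\<^sup>+ s. ennreal (exp (\<theta> * dist_in L ?B (\<lambda>e. \<omega> e s) v y)) \<partial>M) \<le> ennreal (exp (2 * g i') / 2)"
            using i less.IH[of i' y v] \<open>?B = dyadic_box c i' v\<close> by auto
        qed (use th in auto)
        also have "\<dots> = ennreal (exp (2 * g i + 2 * g i') / 2)"
          by (simp add: exp_add ennreal_mult[symmetric] flip: ennreal_numeral)
        also have "\<dots> \<le> ennreal (exp (2 * g j) / 2)"
          using i(4) by (intro ennreal_leI divide_right_mono) auto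
        finally show ?thesis .
      qed
    qed
  qed
  have "exp (2 * g j) / 2 \<le> exp (2 * C * (real j + 1))" for j
  proof -
    have "exp (2 * g j) / 2 \<le> exp (2 * g j)" by simp
    also have "\<dots> \<le> exp (2 * C * (real j + 1))" using gC[of j] by simp
    finally show ?thesis .
  qed
  then have "(\<integral>\<^sup>+ s. ennreal (exp (\<theta> * dist_in L (dyadic_box c j x) (\<lambda>e. \<omega> e s) x y)) \<partial>M)
      \<le> ennreal (exp (2 * C * (real j + 1)))" if "y \<in> dyadic_box c j x" for c j x y
    using main[OF that] by (meson ennreal_leI order_trans)
  moreover have "0 < 2 * C" using C by simp
  ultimately show ?thesis using th(1) by blast
qed

lemma dist_in_upper_tail:
  assumes int2: "(\<integral>\<^sup>+ x \<in> {1<..}. ennreal (- ln (L x) / (x * (ln x)\<^sup>2)) \<partial>lborel) < \<infinity>"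
  shows "\<exists>C>0. \<forall>x j. norm1 x < 2 ^ j \<longrightarrow>
    prob {s \<in> space M. C * (real j + 1) < dist_in L UNIV (\<lambda>e. \<omega> e s) 0 x} \<le> exp (- (real j + 1))"
proof -
  obtain \<theta> C where th: "0 < \<theta>" "0 < C"
    and box: "\<And>c j x y. y \<in> dyadic_box c j x \<Longrightarrow>
      (\<integral>\<^sup>+ s. ennreal (exp (\<theta> * dist_in L (dyadic_box c j x) (\<lambda>e. \<omega> e s) x y)) \<partial>M) \<le> ennreal (exp (C * (real j + 1)))"
    using exp_moment_dyadic_box[OF int2] by blast
  \<comment> \<open>With this threshold, Markov's inequality gives exp(-\<theta> a + C (j + 1)) =
    exp(-(j + 1)).\<close>
  define a where "a j = (C + 1) / \<theta> * (real j + 1)" for j :: nat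
  have "prob {s \<in> space M. a j < dist_in L UNIV (\<lambda>e. \<omega> e s) 0 x} \<le> exp (- (real j + 1))"
    if x: "norm1 x < 2 ^ j" for x j
  proof -
    define c where "c = (\<chi> k. min 0 (x $ k))"
    have xQ: "x \<in> dyadic_box c j 0" unfolding c_def by (rule in_dyadic_box_0[OF x])
    let ?D = "\<lambda>s. dist_in L UNIV (\<lambda>e. \<omega> e s) 0 x"
    have "emeasure M {s \<in> space M. a j < ?D s} = (\<integral>\<^sup>+ s. indicator {s \<in> space M. a j < ?D s} s \<partial>M)"
      by (intro nn_integral_indicator[symmetric]) measurable
    also have "\<dots> \<le> (\<integral>\<^sup>+ s. ennreal (exp (- \<theta> * a j)) *
        ennreal (exp (\<theta> * dist_in L (dyadic_box c j 0) (\<lambda>e. \<omega> e s) 0 x)) \<partial>M)"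
    proof (rule nn_integral_mono)
      fix s
      have "?D s \<le> dist_in L (dyadic_box c j 0) (\<lambda>e. \<omega> e s) 0 x"
        using xQ by (intro dist_in_antimono SV) auto
      then have "1 \<le> exp (- \<theta> * a j) * exp (\<theta> * dist_in L (dyadic_box c j 0) (\<lambda>e. \<omega> e s) 0 x)" if "a j < ?D s"
        using that th by (simp add: exp_add[symmetric])
      then show "indicator {s \<in> space M. a j < ?D s} s \<le> ennreal (exp (- \<theta> * a j)) *
        ennreal (exp (\<theta> * dist_in L (dyadic_box c j 0) (\<lambda>e. \<omega> e s) 0 x))"
        by (auto simp: indicator_def ennreal_mult[symmetric] simp del: exp_minus_inverse simp flip: ennreal_1 intro!: ennreal_leI)
    qed
    also have "\<dots> = ennreal (exp (- \<theta> * a j)) *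
        (\<integral>\<^sup>+ s. ennreal (exp (\<theta> * dist_in L (dyadic_box c j 0) (\<lambda>e. \<omega> e s) 0 x)) \<partial>M)"
      by (intro nn_integral_cmult) measurable
    also have "\<dots> \<le> ennreal (exp (- \<theta> * a j)) * ennreal (exp (C * (real j + 1)))"
      by (intro mult_left_mono box xQ) auto
    also have "\<dots> = ennreal (exp (- (real j + 1)))"
    proof -
      have "\<theta> * a j = (C + 1) * (real j + 1)" using th by (simp add: a_def)
      then show ?thesis by (simp add: ennreal_mult[symmetric] exp_add[symmetric] algebra_simps)
    qed
    finally show ?thesis by (simp add: emeasure_eq_measure)
  qed
  moreover have "0 < (C + 1) / \<theta>" using th by simp
  ultimately show ?thesis unfolding a_def by blast
qed

end

subsection \<open>Sums over walks and the lower tail\<close>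

fun step_prod :: "(int ^ 'd \<Rightarrow> ennreal) \<Rightarrow> (int ^ 'd) list \<Rightarrow> ennreal" where
  "step_prod p (x # y # l) = p (x - y) * step_prod p (y # l)"
| "step_prod p l = 1"

text \<open>The k-fold convolution power of p at y - x. Unfolding the first step suits the induction
  on the distance to the fixed target x.\<close>

fun walk_sum :: "(int ^ 'd \<Rightarrow> ennreal) \<Rightarrow> nat \<Rightarrow> int ^ 'd \<Rightarrow> int ^ 'd \<Rightarrow> ennreal" where
  "walk_sum p 0 y x = (if y = x then 1 else 0)"
| "walk_sum p (Suc k) y x = (\<integral>\<^sup>+ z. p (y - z) * walk_sum p k z x \<partial>count_space UNIV)"

lemma nn_integral_count_space_point:
  "(\<integral>\<^sup>+ z. (if z = a then f z else 0) \<partial>count_space UNIV) = (f a :: ennreal)"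
  by (subst nn_integral_count_space'[of "{a}"]) auto

lemma term_le_suminf_ennreal: "f i \<le> (\<Sum>k. f k :: ennreal)"
  using sum_le_suminf[of f "{i}"] by simp

text \<open>Splits off the first vertex and sums over the second one; Tonelli for counting measures
  exchanges this sum with the sum over the remaining list.\<close>

lemma sum_step_prod_paths:
  "(\<integral>\<^sup>+ l. (if length l = Suc k \<and> hd l = y \<and> last l = x then step_prod p l else 0) \<partial>count_space UNIV)
    = walk_sum p k y x"
proof (induction k arbitrary: y)
  case 0
  have "(\<integral>\<^sup>+ l. (if length l = Suc 0 \<and> hd l = y \<and> last l = x then step_prod p l else 0) \<partial>count_space UNIV)
      = (\<integral>\<^sup>+ l. (if l = [y] then (if y = x then 1 else 0) else 0) \<partial>count_space UNIV)"
    by (intro nn_integral_cong) (auto simp: length_Suc_conv)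
  then show ?case by (simp add: nn_integral_count_space_point)
next
  case (Suc k)
  let ?F = "\<lambda>k y l. (if length l = Suc k \<and> hd l = y \<and> last l = x then step_prod p l else 0)"
  have "(\<integral>\<^sup>+ l. ?F (Suc k) y l \<partial>count_space UNIV)
      = (\<integral>\<^sup>+ l. ?F (Suc k) y l * indicator (range ((#) y)) l \<partial>count_space UNIV)"
    by (intro nn_integral_cong) (auto simp: indicator_def length_Suc_conv)
  also have "\<dots> = (\<integral>\<^sup>+ l. ?F (Suc k) y l \<partial>count_space (range ((#) y)))"
    by (subst nn_integral_count_space_indicator) (auto simp: NO_MATCH_def)
  also have "\<dots> = (\<integral>\<^sup>+ l. ?F (Suc k) y (y # l) \<partial>count_space UNIV)"
    by (rule nn_integral_bij_count_space[symmetric]) (auto simp: bij_betw_def inj_on_def)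
  also have "\<dots> = (\<integral>\<^sup>+ l. \<integral>\<^sup>+ z. p (y - z) * ?F k z l \<partial>count_space UNIV \<partial>count_space UNIV)"
  proof (rule nn_integral_cong)
    fix l
    have "(\<integral>\<^sup>+ z. p (y - z) * ?F k z l \<partial>count_space UNIV)
        = (\<integral>\<^sup>+ z. (if z = hd l then p (y - z) * ?F k z l else 0) \<partial>count_space UNIV)"
      by (intro nn_integral_cong) auto
    also have "\<dots> = p (y - hd l) * ?F k (hd l) l"
      by (rule nn_integral_count_space_point)
    also have "\<dots> = ?F (Suc k) y (y # l)" by (cases l) auto
    finally show "?F (Suc k) y (y # l) = (\<integral>\<^sup>+ z. p (y - z) * ?F k z l \<partial>count_space UNIV)" ..
  qed
  also have "\<dots> = (\<integral>\<^sup>+ z. \<integral>\<^sup>+ l. p (y - z) * ?F k z l \<partial>count_space UNIV \<partial>count_space UNIV)"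
    by (intro nn_integral_count_space_nn_integral countableI_type) auto
  also have "\<dots> = (\<integral>\<^sup>+ z. p (y - z) * walk_sum p k z x \<partial>count_space UNIV)"
    by (simp only: nn_integral_cmult[OF borel_measurable_count_space] Suc.IH)
  finally show ?case by simp
qed

lemma nn_integral_count_space_translate:
  fixes p :: "int ^ 'd \<Rightarrow> ennreal"
  shows "(\<integral>\<^sup>+ y. p (y - z) \<partial>count_space UNIV) = (\<integral>\<^sup>+ y. p y \<partial>count_space UNIV)"
    and "(\<integral>\<^sup>+ y. p (z - y) \<partial>count_space UNIV) = (\<integral>\<^sup>+ y. p y \<partial>count_space UNIV)"
proof -
  have "bij_betw (\<lambda>y. y - z) UNIV UNIV" by (rule bij_betw_byWitness[where f'="\<lambda>y. y + z"]) auto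
  then show "(\<integral>\<^sup>+ y. p (y - z) \<partial>count_space UNIV) = (\<integral>\<^sup>+ y. p y \<partial>count_space UNIV)"
    by (rule nn_integral_bij_count_space)
  have "bij_betw (\<lambda>y. z - y) UNIV UNIV" by (rule bij_betw_byWitness[where f'="\<lambda>y. z - y"]) auto
  then show "(\<integral>\<^sup>+ y. p (z - y) \<partial>count_space UNIV) = (\<integral>\<^sup>+ y. p y \<partial>count_space UNIV)"
    by (rule nn_integral_bij_count_space)
qed

lemma walk_sum_total:
  assumes p: "(\<integral>\<^sup>+ z. p z \<partial>count_space UNIV) \<le> ennreal q" and q: "0 \<le> q"
  shows "(\<integral>\<^sup>+ y. walk_sum p k y x \<partial>count_space UNIV) \<le> ennreal (q ^ k)"
proof (induction k)
  case 0 show ?case by (simp add: nn_integral_count_space_point)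
next
  case (Suc k)
  have "(\<integral>\<^sup>+ y. walk_sum p (Suc k) y x \<partial>count_space UNIV)
      = (\<integral>\<^sup>+ y. \<integral>\<^sup>+ z. p (y - z) * walk_sum p k z x \<partial>count_space UNIV \<partial>count_space UNIV)" by simp
  also have "\<dots> = (\<integral>\<^sup>+ z. \<integral>\<^sup>+ y. p (y - z) * walk_sum p k z x \<partial>count_space UNIV \<partial>count_space UNIV)"
    by (intro nn_integral_count_space_nn_integral countableI_type) auto
  also have "\<dots> = (\<integral>\<^sup>+ z. (\<integral>\<^sup>+ y. p y \<partial>count_space UNIV) * walk_sum p k z x \<partial>count_space UNIV)"
    by (simp only: nn_integral_multc[OF borel_measurable_count_space] nn_integral_count_space_translate)
  also have "\<dots> = (\<integral>\<^sup>+ y. p y \<partial>count_space UNIV) * (\<integral>\<^sup>+ z. walk_sum p k z x \<partial>count_space UNIV)"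
    by (rule nn_integral_cmult) simp
  also have "\<dots> \<le> ennreal q * ennreal (q ^ k)" by (intro mult_mono p Suc) auto
  also have "\<dots> = ennreal (q ^ Suc k)" using q by (simp add: ennreal_mult[symmetric])
  finally show ?case .
qed

text \<open>One of the \<open>k\<close> steps of a walk from \<open>y\<close> to \<open>x\<close> has length at least \<open>norm1 (y - x) / k\<close>.\<close>

lemma walk_sum_le:
  assumes p: "(\<integral>\<^sup>+ z. p z \<partial>count_space UNIV) \<le> ennreal q" and q: "0 < q" and C: "0 \<le> C"
    and decay: "\<And>z. z \<noteq> 0 \<Longrightarrow> p z \<le> ennreal (C / norm1 z)"
    and yx: "y \<noteq> x"
  shows "walk_sum p k y x \<le> ennreal (C / q * (real k)\<^sup>2 * q ^ k / norm1 (y - x))"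
  using yx
proof (induction k arbitrary: y)
  case 0 then show ?case by simp
next
  case (Suc k y)
  define n where "n = norm1 (y - x)"
  have n: "0 < n" using norm1_ge_1[of "y - x"] Suc.prems unfolding n_def by simp
  \<comment> \<open>Case split on the first step. If it covers at least n/(k+1), its weight is at
    most \<open>c1\<close> and the remaining steps contribute their total mass q^k. Otherwise the
    other k steps cover more than n k/(k+1), and the induction hypothesis bounds them by
    \<open>c2\<close>. The sum closes because (k+1) + k (k+1) = (k+1)^2.\<close>
  define c1 where "c1 = C * (real k + 1) / n"
  define c2 where "c2 = C / q * real k * (real k + 1) * q ^ k / n"
  have c0: "0 \<le> c1" "0 \<le> c2" using n q C unfolding c1_def c2_def by auto
  have pt: "p (y - z) * walk_sum p k z x \<le> ennreal c1 * walk_sum p k z x + ennreal c2 * p (y - z)" for z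
  proof (cases "n / (real k + 1) \<le> norm1 (y - z)")
    case True
    have "0 < n / (real k + 1)" using n by simp
    then have "0 < norm1 (y - z)" using True by linarith
    then have "y - z \<noteq> 0" by auto
    then have "p (y - z) \<le> ennreal (C / norm1 (y - z))" by (rule decay)
    also have "\<dots> \<le> ennreal c1"
    proof (rule ennreal_leI)
      have "C / norm1 (y - z) \<le> C / (n / (real k + 1))"
        using True C \<open>0 < n / (real k + 1)\<close> \<open>0 < norm1 (y - z)\<close> by (intro divide_left_mono mult_pos_pos)
      then show "C / norm1 (y - z) \<le> c1" by (simp add: c1_def)
    qed
    finally have "p (y - z) * walk_sum p k z x \<le> ennreal c1 * walk_sum p k z x"
      by (intro mult_right_mono) auto
    then show ?thesis by (simp add: add_increasing2)
  next
    case False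
    have "n \<le> norm1 (y - z) + norm1 (z - x)" unfolding n_def by (rule norm1_triangle)
    then have "n - n / (real k + 1) < norm1 (z - x)" using False by linarith
    moreover have "n - n / (real k + 1) = n * real k / (real k + 1)" by (simp add: field_simps)
    ultimately have m: "n * real k / (real k + 1) < norm1 (z - x)" by simp
    moreover have "0 \<le> n * real k / (real k + 1)" using n by simp
    ultimately have m0: "0 < norm1 (z - x)" by linarith
    then have "z \<noteq> x" by auto
    then have "walk_sum p k z x \<le> ennreal (C / q * (real k)\<^sup>2 * q ^ k / norm1 (z - x))" by (rule Suc.IH)
    also have "\<dots> \<le> ennreal c2"
    proof (rule ennreal_leI)
      have "n * real k \<le> norm1 (z - x) * (real k + 1)" using m by (simp add: divide_less_eq)
      then have "real k * (n * real k) \<le> real k * (norm1 (z - x) * (real k + 1))"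
        by (intro mult_left_mono) auto
      then have "(real k)\<^sup>2 / norm1 (z - x) \<le> real k * (real k + 1) / n"
        using n m0 by (simp add: field_simps power2_eq_square)
      then have "C / q * q ^ k * ((real k)\<^sup>2 / norm1 (z - x)) \<le> C / q * q ^ k * (real k * (real k + 1) / n)"
        using C q by (intro mult_left_mono) auto
      then show "C / q * (real k)\<^sup>2 * q ^ k / norm1 (z - x) \<le> c2" by (simp add: c2_def mult_ac)
    qed
    finally have "p (y - z) * walk_sum p k z x \<le> p (y - z) * ennreal c2"
      by (intro mult_left_mono) auto
    then show ?thesis by (simp add: add_increasing mult.commute)
  qed
  have "walk_sum p (Suc k) y x
      \<le> (\<integral>\<^sup>+ z. ennreal c1 * walk_sum p k z x + ennreal c2 * p (y - z) \<partial>count_space UNIV)"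
    unfolding walk_sum.simps by (intro nn_integral_mono pt)
  also have "\<dots> = ennreal c1 * (\<integral>\<^sup>+ z. walk_sum p k z x \<partial>count_space UNIV) + ennreal c2 * (\<integral>\<^sup>+ z. p z \<partial>count_space UNIV)"
    by (subst nn_integral_add) (auto simp: nn_integral_cmult nn_integral_count_space_translate)
  also have "\<dots> \<le> ennreal c1 * ennreal (q ^ k) + ennreal c2 * ennreal q"
    using q by (intro add_mono mult_left_mono walk_sum_total p) auto
  also have "\<dots> = ennreal (c1 * q ^ k + c2 * q)"
  proof -
    have "0 \<le> c1 * q ^ k" "0 \<le> c2 * q" using c0 q by auto
    then have "ennreal (c1 * q ^ k + c2 * q) = ennreal (c1 * q ^ k) + ennreal (c2 * q)" by (rule ennreal_plus)
    also have "\<dots> = ennreal c1 * ennreal (q ^ k) + ennreal c2 * ennreal q"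
      using c0 q by (simp only: ennreal_mult zero_le_power less_imp_le)
    finally show ?thesis ..
  qed
  also have "c1 * q ^ k + c2 * q = C / q * (real (Suc k))\<^sup>2 * q ^ Suc k / norm1 (y - x)"
    using q n unfolding c1_def c2_def n_def[symmetric] by (simp add: field_simps power2_eq_square)
  finally show ?case .
qed

text \<open>Mass 1/8 per step beats the polynomial factor: k^2 <= 4^k, so k^2 / 8^k <= 2^(-k). The
  geometric sum is 2, and 8 * 2 = 16.\<close>

lemma suminf_walk_sum_le:
  assumes p: "(\<integral>\<^sup>+ z. p z \<partial>count_space UNIV) \<le> ennreal (1/8)" and C: "0 \<le> C"
    and decay: "\<And>z. z \<noteq> 0 \<Longrightarrow> p z \<le> ennreal (C / norm1 z)"
    and yx: "y \<noteq> x"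
  shows "(\<Sum>k. walk_sum p k y x) \<le> ennreal (16 * C / norm1 (y - x))"
proof -
  have "walk_sum p k y x \<le> ennreal (8 * C / norm1 (y - x) * (1/2) ^ k)" for k
  proof -
    have "walk_sum p k y x \<le> ennreal (C / (1/8) * (real k)\<^sup>2 * (1/8) ^ k / norm1 (y - x))"
      by (rule walk_sum_le[OF p _ C decay yx]) auto
    also have "\<dots> \<le> ennreal (8 * C / norm1 (y - x) * (1/2) ^ k)"
    proof (rule ennreal_leI)
      have "(real k)\<^sup>2 \<le> (2 ^ k)\<^sup>2"
        using of_nat_less_two_power[of k, where ?'a=real] by (intro power_mono) auto
      also have "\<dots> = 4 ^ k" by (simp add: power2_eq_square power_mult_distrib[symmetric])
      finally have "(real k)\<^sup>2 * (1/8) ^ k \<le> 4 ^ k * (1/8) ^ k" by (intro mult_right_mono) auto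
      also have "\<dots> = (1/2) ^ k" by (simp add: power_mult_distrib[symmetric])
      finally have "8 * C / norm1 (y - x) * ((real k)\<^sup>2 * (1/8) ^ k) \<le> 8 * C / norm1 (y - x) * (1/2) ^ k"
        using C norm1_nonneg[of "y - x"] by (intro mult_left_mono) auto
      then show "C / (1/8) * (real k)\<^sup>2 * (1/8) ^ k / norm1 (y - x) \<le> 8 * C / norm1 (y - x) * (1/2) ^ k"
        by (simp add: mult_ac)
    qed
    finally show ?thesis .
  qed
  then have "(\<Sum>k. walk_sum p k y x) \<le> (\<Sum>k. ennreal (8 * C / norm1 (y - x) * (1/2) ^ k))"
    by (intro suminf_le) auto
  also have "\<dots> = ennreal (\<Sum>k. 8 * C / norm1 (y - x) * (1/2) ^ k)"
    using C norm1_nonneg[of "y - x"] by (intro suminf_ennreal2 summable_mult summable_geometric) auto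
  also have "(\<Sum>k. 8 * C / norm1 (y - x) * (1/2) ^ k) = 8 * C / norm1 (y - x) * 2"
    by (subst suminf_mult) (auto simp: suminf_geometric)
  finally show ?thesis by simp
qed

section \<open>Total jump rate and the lower tail\<close>

context long_range_fpp
begin

text \<open>A summable sequence is bounded, and d >= 1 leaves at least one power of the distance.
  The factor 2 is lost in passing from a length to the power of two below it.\<close>

lemma rate_le_inverse_norm:
  assumes sL: "summable (\<lambda>j. L (2 ^ j))"
  shows "\<exists>C>0. \<forall>z::int ^ 'd. z \<noteq> 0 \<longrightarrow> rate CARD('d) L (norm1 z) \<le> C / norm1 z"
proof -
  have "Bseq (\<lambda>j. L (2 ^ j))"
    using summable_LIMSEQ_zero[OF sL] by (intro convergent_imp_Bseq convergentI)
  then obtain K where K: "0 < K" "\<And>j. norm (L (2 ^ j)) \<le> K" unfolding Bseq_def by blast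
  have "rate CARD('d) L (norm1 z) \<le> 2 * K / norm1 z" if "z \<noteq> 0" for z :: "int ^ 'd"
  proof -
    obtain n where n: "norm1 z = real n" using norm1_eq_of_nat by blast
    have n1: "1 \<le> n" using norm1_ge_1[OF that] n by simp
    obtain j where j: "2 ^ j \<le> n" "n < 2 ^ (j + 1)" using ex_power_ivl1[of 2 n] n1 by auto
    have "rate CARD('d) L (real n) \<le> rate CARD('d) L (real (2 ^ j))"
      using j by (intro rate_antimono) auto
    also have "\<dots> = L (2 ^ j) / 2 ^ (j * CARD('d))" using rate_dyadic[of j] by simp
    also have "\<dots> \<le> K / 2 ^ j"
    proof (rule frac_le)
      show "L (2 ^ j) \<le> K" using K(2)[of j] by simp
      show "(2::real) ^ j \<le> 2 ^ (j * CARD('d))" by (intro power_increasing) auto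
    qed (use K in auto)
    also have "\<dots> \<le> 2 * K / real n"
    proof -
      have "real n \<le> real (2 ^ (j + 1))" using j by (intro of_nat_mono) auto
      then have "K * real n \<le> K * (2 * 2 ^ j)" using K by (intro mult_left_mono) auto
      then show ?thesis using n1 by (simp add: field_simps)
    qed
    finally show ?thesis using n by simp
  qed
  then show ?thesis using K(1) by (intro exI[of _ "2 * K"]) auto
qed

text \<open>The value 0 at the origin makes lists with equal consecutive vertices contribute
  nothing, so sums may run over all lists of lattice points.\<close>

definition edge_rate :: "int ^ 'd \<Rightarrow> ennreal" where
  "edge_rate z = (if z = 0 then 0 else ennreal (rate CARD('d) L (norm1 z)))"

text \<open>The shell of points of length about 2^j lies in a cube of 4^d 2^(jd) points and has
  rates at most L(2^j) / 2^(jd), so it contributes at most 4^d L(2^j).\<close>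

lemma total_rate_finite:
  assumes sL: "summable (\<lambda>j. L (2 ^ j))"
  shows "(\<integral>\<^sup>+ z. edge_rate z \<partial>count_space UNIV) < \<infinity>"
proof -
  have Lpos: "0 < L (2 ^ j)" for j :: nat using SV by (auto simp: slowly_varying_def)
  define D where "D j = {z::int ^ 'd. \<forall>k. z $ k \<in> {- (2 ^ (j + 1)) ..< 2 ^ (j + 1)}}" for j :: nat
  have finD: "finite (D j)" for j unfolding D_def by (intro finite_vec_box) auto
  have cardD: "card (D j) = 2 ^ (2 * CARD('d)) * 2 ^ (j * CARD('d))" for j
  proof -
    have "card (D j) = (\<Prod>k\<in>(UNIV :: 'd set). 4 * 2 ^ j)"
      unfolding D_def by (subst finite_vec_box(2)) (simp_all add: nat_power_eq nat_mult_distrib)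
    also have "\<dots> = 4 ^ CARD('d) * 2 ^ (j * CARD('d))"
      by (simp add: power_mult_distrib power_mult[of _ j])
    finally show ?thesis by (simp add: power_mult)
  qed
  have "edge_rate z \<le> (\<Sum>j. ennreal (rate CARD('d) L (2 ^ j)) * indicator (D j) z)" for z
  proof (cases "z = 0")
    case False
    obtain n where n: "norm1 z = real n" using norm1_eq_of_nat by blast
    have n1: "1 \<le> n" using norm1_ge_1[OF False] n by simp
    obtain j where j: "2 ^ j \<le> n" "n < 2 ^ (j + 1)" using ex_power_ivl1[of 2 n] n1 by auto
    have "z \<in> D j" unfolding D_def
    proof (intro CollectI allI)
      fix k
      have "real n < real (2 ^ (j + 1))" using j by (intro of_nat_less_iff[THEN iffD2])
      then have "real_of_int \<bar>z $ k\<bar> < real_of_int (2 ^ (j + 1))" using abs_le_norm1[of z k] n by simp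
      then have "\<bar>z $ k\<bar> < 2 ^ (j + 1)" by (simp only: of_int_less_iff)
      then show "z $ k \<in> {- (2 ^ (j + 1)) ..< 2 ^ (j + 1)}" by (auto simp: abs_less_iff)
    qed
    have "rate CARD('d) L (real n) \<le> rate CARD('d) L (real (2 ^ j))"
      using j by (intro rate_antimono) auto
    then have "edge_rate z \<le> ennreal (rate CARD('d) L (2 ^ j)) * indicator (D j) z"
      using \<open>z \<in> D j\<close> False n by (simp add: edge_rate_def ennreal_leI)
    also have "\<dots> \<le> (\<Sum>j. ennreal (rate CARD('d) L (2 ^ j)) * indicator (D j) z)"
      by (rule term_le_suminf_ennreal)
    finally show ?thesis .
  qed (simp add: edge_rate_def)
  then have "(\<integral>\<^sup>+ z. edge_rate z \<partial>count_space UNIV)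
      \<le> (\<integral>\<^sup>+ z. (\<Sum>j. ennreal (rate CARD('d) L (2 ^ j)) * indicator (D j) z) \<partial>count_space UNIV)"
    by (intro nn_integral_mono)
  also have "\<dots> = (\<Sum>j. \<integral>\<^sup>+ z. ennreal (rate CARD('d) L (2 ^ j)) * indicator (D j) z \<partial>count_space UNIV)"
    by (intro nn_integral_suminf) simp
  also have "\<dots> = (\<Sum>j. ennreal (2 ^ (2 * CARD('d)) * L (2 ^ j)))"
  proof (rule suminf_cong)
    fix j
    have "(\<integral>\<^sup>+ z. ennreal (rate CARD('d) L (2 ^ j)) * indicator (D j) z \<partial>count_space UNIV)
        = ennreal (rate CARD('d) L (2 ^ j)) * ennreal (real (card (D j)))"
      by (simp add: nn_integral_cmult_indicator finD ennreal_of_nat_eq_real_of_nat)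
    also have "\<dots> = ennreal (rate CARD('d) L (2 ^ j) * real (card (D j)))"
      by (rule ennreal_mult''[symmetric]) simp
    also have "rate CARD('d) L (2 ^ j) * real (card (D j)) = 2 ^ (2 * CARD('d)) * L (2 ^ j)"
      by (simp add: cardD rate_dyadic)
    finally show "(\<integral>\<^sup>+ z. ennreal (rate CARD('d) L (2 ^ j)) * indicator (D j) z \<partial>count_space UNIV)
        = ennreal (2 ^ (2 * CARD('d)) * L (2 ^ j))" .
  qed
  also have "\<dots> = ennreal (\<Sum>j. 2 ^ (2 * CARD('d)) * L (2 ^ j))"
    using Lpos by (intro suminf_ennreal2 summable_mult sL) (auto simp: less_imp_le)
  also have "\<dots> < \<infinity>" by simp
  finally show ?thesis .
qed

text \<open>An edge of rate r has Laplace transform r / (r + \<theta>) <= r / \<theta>. The first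
  edge is independent of the rest since its first vertex never recurs.\<close>

lemma simple_path_exp_moment:
  assumes th: "0 < \<theta>" and "is_path l" "distinct l"
  shows "(\<integral>\<^sup>+ s. ennreal (exp (- \<theta> * path_cost L (\<lambda>e. \<omega> e s) l)) \<partial>M)
    \<le> step_prod (\<lambda>z. edge_rate z * ennreal (1 / \<theta>)) l"
  using assms(2,3)
proof (induction l rule: induct_list012)
  case (3 x y l)
  let ?r = "rate CARD('d) L (norm1 (x - y))"
  have xy: "x \<noteq> y" "x \<notin> set (y # l)" using 3 by auto
  have r: "0 < ?r" using xy by (intro rate_pos SV norm1_ge_1) auto
  define f where "f w = ennreal (exp (- (\<theta> / ?r) * max 0 (w {x, y})))" for w :: "(int ^ 'd) set \<Rightarrow> real"
  define g where "g w = ennreal (exp (- \<theta> * path_cost L w (y # l)))" for w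
  let ?E = "edges_in (set (y # l))"
  have meas: "(\<lambda>w. path_cost L w (y # l)) \<in> borel_measurable (PiM ?E (\<lambda>_. borel))"
    using 3 by (intro path_cost_measurable) auto
  have comp: "(\<lambda>w. w {x, y} :: real) \<in> borel_measurable (PiM {{x, y}} (\<lambda>_. borel))"
    by (rule measurable_component_singleton) simp
  have "(\<integral>\<^sup>+ s. f (\<lambda>e. \<omega> e s) * g (\<lambda>e. \<omega> e s) * 1 \<partial>M)
      = (\<integral>\<^sup>+ s. f (\<lambda>e. \<omega> e s) \<partial>M) * (\<integral>\<^sup>+ s. g (\<lambda>e. \<omega> e s) \<partial>M) * (\<integral>\<^sup>+ s. 1 \<partial>M)"
  proof (rule indep_vars_nn_integral_3[OF indep, of "{{x, y}}" ?E "{}" f g "\<lambda>_. 1"])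
    show "f \<in> borel_measurable (PiM {{x, y}} (\<lambda>_. borel))"
      unfolding f_def using comp by measurable
    show "g \<in> borel_measurable (PiM ?E (\<lambda>_. borel))"
      unfolding g_def using meas by measurable
    show "g (restrict w ?E) = g w" for w
      unfolding g_def using 3 by (subst path_cost_cong[of "y # l" "set (y # l)" _ w]) auto
    show "{{x, y}} \<inter> ?E = {}" using xy by (auto simp: edges_in_def)
  qed (use xy in \<open>auto simp: f_def edges_in_def edge_in_edges\<close>)
  moreover have "ennreal (exp (- \<theta> * path_cost L (\<lambda>e. \<omega> e s) (x # y # l))) = f (\<lambda>e. \<omega> e s) * g (\<lambda>e. \<omega> e s) * 1" for s
    by (simp add: f_def g_def ennreal_mult[symmetric] exp_add[symmetric] cost_def distrib_left)
  ultimately have "(\<integral>\<^sup>+ s. ennreal (exp (- \<theta> * path_cost L (\<lambda>e. \<omega> e s) (x # y # l))) \<partial>M)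
      = (\<integral>\<^sup>+ s. f (\<lambda>e. \<omega> e s) \<partial>M) * (\<integral>\<^sup>+ s. g (\<lambda>e. \<omega> e s) \<partial>M)"
    by (simp add: emeasure_space_1)
  also have "\<dots> \<le> (edge_rate (x - y) * ennreal (1 / \<theta>)) * step_prod (\<lambda>z. edge_rate z * ennreal (1 / \<theta>)) (y # l)"
  proof (rule mult_mono)
    have "(\<integral>\<^sup>+ s. f (\<lambda>e. \<omega> e s) \<partial>M) = ennreal (1 / (1 - (- (\<theta> / ?r))))"
      unfolding f_def
    proof (intro exponential_exp_moment expo edge_in_edges xy)
      have "0 < \<theta> / ?r" using r th by simp
      then show "- (\<theta> / ?r) < 1" by linarith
    qed simp
    also have "\<dots> \<le> ennreal (?r * (1 / \<theta>))"
      using r th by (intro ennreal_leI) (simp add: field_simps)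
    also have "\<dots> = edge_rate (x - y) * ennreal (1 / \<theta>)"
      using xy r th by (simp add: edge_rate_def ennreal_mult[symmetric])
    finally show "(\<integral>\<^sup>+ s. f (\<lambda>e. \<omega> e s) \<partial>M) \<le> edge_rate (x - y) * ennreal (1 / \<theta>)" .
    show "(\<integral>\<^sup>+ s. g (\<lambda>e. \<omega> e s) \<partial>M) \<le> step_prod (\<lambda>z. edge_rate z * ennreal (1 / \<theta>)) (y # l)"
      unfolding g_def using 3 by auto
  qed auto
  finally show ?case by simp
qed (auto simp: emeasure_space_1)

lemma path_cost_omega_measurable:
  assumes "is_path l" shows "(\<lambda>s. path_cost L (\<lambda>e. \<omega> e s) l) \<in> borel_measurable M"
  using assms
proof (induction l rule: induct_list012)
  case (3 x y l)
  then have [measurable]: "\<omega> {x, y} \<in> borel_measurable M"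
    "(\<lambda>s. path_cost L (\<lambda>e. \<omega> e s) (y # l)) \<in> borel_measurable M"
    by (auto intro: omega_measurable edge_in_edges)
  show ?case unfolding path_cost.simps cost_def by measurable
qed auto

lemma dist_in_lower_tail:
  assumes sL: "summable (\<lambda>j. L (2 ^ j))"
  shows "\<exists>\<theta>>0. \<exists>K>0. \<forall>x t. x \<noteq> 0 \<longrightarrow>
    prob {s \<in> space M. dist_in L UNIV (\<lambda>e. \<omega> e s) 0 x < t} \<le> K * exp (\<theta> * t) / norm1 x"
proof -
  obtain C where C: "0 < C" "\<And>z::int ^ 'd. z \<noteq> 0 \<Longrightarrow> rate CARD('d) L (norm1 z) \<le> C / norm1 z"
    using rate_le_inverse_norm[OF sL] by blast
  obtain l where l: "0 \<le> l" "(\<integral>\<^sup>+ z. edge_rate z \<partial>count_space UNIV) = ennreal l"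
    using total_rate_finite[OF sL] by (cases "\<integral>\<^sup>+ z. edge_rate z \<partial>count_space UNIV") auto
  \<comment> \<open>Brings the total step weight l / \<theta> below 1/8; the added 1 keeps \<theta>
    positive.\<close>
  define \<theta> where "\<theta> = 8 * (l + 1)"
  have th: "0 < \<theta>" using l by (simp add: \<theta>_def)
  define p where "p z = edge_rate z * ennreal (1 / \<theta>)" for z :: "int ^ 'd"
  have "(\<integral>\<^sup>+ z. p z \<partial>count_space UNIV) = ennreal (l * (1 / \<theta>))"
    unfolding p_def using l th by (simp add: nn_integral_multc ennreal_mult[symmetric])
  also have "\<dots> \<le> ennreal (1/8)"
    using l by (intro ennreal_leI) (simp add: \<theta>_def field_simps)
  finally have p1: "(\<integral>\<^sup>+ z. p z \<partial>count_space UNIV) \<le> ennreal (1/8)" .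
  have p2: "p z \<le> ennreal (C / \<theta> / norm1 z)" if "z \<noteq> 0" for z
  proof -
    have "0 < rate CARD('d) L (norm1 z)" using that by (intro rate_pos SV norm1_ge_1)
    then have "p z = ennreal (rate CARD('d) L (norm1 z) * (1 / \<theta>))"
      using that th by (simp add: p_def edge_rate_def ennreal_mult[symmetric])
    also have "\<dots> \<le> ennreal (C / norm1 z * (1 / \<theta>))"
      using th C(2)[OF that] by (intro ennreal_leI mult_right_mono) auto
    finally show ?thesis by (simp add: mult_ac)
  qed
  define K where "K = 16 * (C / \<theta>)"
  have "prob {s \<in> space M. dist_in L UNIV (\<lambda>e. \<omega> e s) 0 x < t} \<le> K * exp (\<theta> * t) / norm1 x"
    if x: "x \<noteq> 0" for x t
  proof -
    let ?D = "\<lambda>s. dist_in L UNIV (\<lambda>e. \<omega> e s) 0 x"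
    define P where "P = {q. is_path q \<and> distinct q \<and> hd q = 0 \<and> last q = x}"
    let ?f = "\<lambda>q s. ennreal (exp (\<theta> * t)) * ennreal (exp (- \<theta> * path_cost L (\<lambda>e. \<omega> e s) q))"
    have fm: "?f q \<in> borel_measurable M" if "q \<in> P" for q
    proof -
      have [measurable]: "(\<lambda>s. path_cost L (\<lambda>e. \<omega> e s) q) \<in> borel_measurable M"
        using that by (intro path_cost_omega_measurable) (auto simp: P_def)
      show ?thesis by measurable
    qed
    have "emeasure M {s \<in> space M. ?D s < t} = (\<integral>\<^sup>+ s. indicator {s \<in> space M. ?D s < t} s \<partial>M)"
      by (intro nn_integral_indicator[symmetric]) measurable
    also have "\<dots> \<le> (\<integral>\<^sup>+ s. \<integral>\<^sup>+ q. ?f q s \<partial>count_space P \<partial>M)"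
    proof (rule nn_integral_mono)
      fix s
      show "indicator {s \<in> space M. ?D s < t} s \<le> (\<integral>\<^sup>+ q. ?f q s \<partial>count_space P)"
      proof (cases "?D s < t")
        case True
        obtain q where q: "q \<in> paths_in UNIV 0 x" "path_cost L (\<lambda>e. \<omega> e s) q < t"
          using dist_in_less_obtain[OF _ _ True] by auto
        obtain q' where q': "is_path q'" "distinct q'" "hd q' = hd q" "last q' = last q"
          "path_cost L (\<lambda>e. \<omega> e s) q' \<le> path_cost L (\<lambda>e. \<omega> e s) q"
          by (rule obtain_simple_path[OF SV]) (use q in \<open>auto simp: paths_in_def\<close>)
        have q'P: "q' \<in> P" using q q' by (auto simp: P_def paths_in_def)
        \<comment> \<open>A union bound in exponential form: a path cheaper than t has exp(\<theta>
          (t - cost)) >= 1, so the sum of these terms over simple paths dominates the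
          indicator.\<close>
        have "0 \<le> \<theta> * (t - path_cost L (\<lambda>e. \<omega> e s) q')" using th q q' by simp
        then have "1 \<le> exp (\<theta> * t) * exp (- \<theta> * path_cost L (\<lambda>e. \<omega> e s) q')"
          by (simp add: exp_add[symmetric] right_diff_distrib)
        from ennreal_leI[OF this] have "1 \<le> ?f q' s" by (simp add: ennreal_mult)
        also have "\<dots> \<le> (\<integral>\<^sup>+ q. ?f q s \<partial>count_space P)" by (rule nn_integral_ge_point[OF q'P])
        finally show ?thesis by (auto simp: indicator_def)
      qed auto
    qed
    also have "\<dots> = (\<integral>\<^sup>+ q. \<integral>\<^sup>+ s. ?f q s \<partial>M \<partial>count_space P)"
      by (intro nn_integral_count_space_nn_integral countableI_type fm)
    also have "\<dots> \<le> (\<integral>\<^sup>+ q. ennreal (exp (\<theta> * t)) * step_prod p q \<partial>count_space P)"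
    proof (rule nn_integral_mono)
      fix q assume "q \<in> space (count_space P)"
      then have q: "is_path q" "distinct q" by (auto simp: P_def)
      have "(\<integral>\<^sup>+ s. ?f q s \<partial>M) = ennreal (exp (\<theta> * t)) * (\<integral>\<^sup>+ s. ennreal (exp (- \<theta> * path_cost L (\<lambda>e. \<omega> e s) q)) \<partial>M)"
        using path_cost_omega_measurable[OF q(1)] by (intro nn_integral_cmult) measurable
      also have "\<dots> \<le> ennreal (exp (\<theta> * t)) * step_prod p q"
        unfolding p_def by (intro mult_left_mono simple_path_exp_moment th q) auto
      finally show "(\<integral>\<^sup>+ s. ?f q s \<partial>M) \<le> ennreal (exp (\<theta> * t)) * step_prod p q" .
    qed
    also have "\<dots> = ennreal (exp (\<theta> * t)) * (\<integral>\<^sup>+ q. step_prod p q * indicator P q \<partial>count_space UNIV)"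
      by (simp add: nn_integral_cmult nn_integral_count_space_indicator)
    \<comment> \<open>Simplicity has served for the moments; the sum is now enlarged to all lists
      from 0 to x, each counted once, at k equal to its number of steps.\<close>
    also have "\<dots> \<le> ennreal (exp (\<theta> * t)) * (\<integral>\<^sup>+ q. (\<Sum>k. if length q = Suc k \<and> hd q = 0 \<and> last q = x then step_prod p q else 0) \<partial>count_space UNIV)"
    proof (intro mult_left_mono nn_integral_mono)
      fix q :: "(int ^ 'd) list"
      let ?g = "\<lambda>k. if length q = Suc k \<and> hd q = 0 \<and> last q = x then step_prod p q else 0"
      have "step_prod p q * indicator P q \<le> ?g (length q - 1)"
        by (cases q) (auto simp: P_def indicator_def)
      also have "\<dots> \<le> (\<Sum>k. ?g k)"
        by (rule term_le_suminf_ennreal)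
      finally show "step_prod p q * indicator P q \<le> (\<Sum>k. ?g k)" .
    qed simp
    also have "\<dots> = ennreal (exp (\<theta> * t)) * (\<Sum>k. walk_sum p k 0 x)"
      by (subst nn_integral_suminf) (auto simp: sum_step_prod_paths)
    also have "\<dots> \<le> ennreal (exp (\<theta> * t)) * ennreal (16 * (C / \<theta>) / norm1 (0 - x))"
      using C th x by (intro mult_left_mono suminf_walk_sum_le p1 p2) auto
    also have "\<dots> = ennreal (K * exp (\<theta> * t) / norm1 x)"
      using C th norm1_nonneg[of x] by (simp add: ennreal_mult[symmetric] K_def norm1_minus_commute[of 0 x, simplified] mult_ac)
    finally have "ennreal (prob {s \<in> space M. ?D s < t}) \<le> ennreal (K * exp (\<theta> * t) / norm1 x)"
      by (simp add: emeasure_eq_measure)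
    moreover have "0 \<le> K * exp (\<theta> * t) / norm1 x" using C th norm1_nonneg[of x] by (simp add: K_def)
    ultimately show ?thesis by (simp add: ennreal_le_iff)
  qed
  moreover have "0 < K" using C th by (simp add: K_def)
  ultimately show ?thesis using th by blast
qed

end

section \<open>Logarithmic passage times and growth of the expected ball\<close>

context long_range_fpp
begin

text \<open>One null set for all edges, by countability: outside it the truncated costs agree with
  the original weights, simultaneously for all end points.\<close>

lemma AE_omega_nonneg: "AE s in M. \<forall>e\<in>edges. 0 \<le> \<omega> e s"
proof (rule AE_ball_countable[OF countable_edges, THEN iffD2], rule ballI)
  fix e :: "(int ^ 'd) set" assume e: "e \<in> edges"
  have "AE x in density lborel (exponential_density 1). 0 \<le> x"
    by (subst AE_density) (auto simp: exponential_density_def intro!: AE_I2)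
  then have 1: "AE x in distr M lborel (\<omega> e). 0 \<le> x"
    unfolding distributed_distr_eq_density[OF expo[OF e]] .
  have "\<omega> e \<in> measurable M lborel" using omega_measurable[OF e] by simp
  from AE_distrD[OF this 1] show "AE s in M. 0 \<le> \<omega> e s" .
qed

lemma AE_passage_time_eq:
  "AE s in M. passage_time L \<omega> s x y = dist_in L UNIV (\<lambda>e. \<omega> e s) x y"
  using AE_omega_nonneg by eventually_elim (auto intro: passage_time_eq_dist_in)

lemma passage_time_logarithmic:
  assumes sL: "summable (\<lambda>j. L (2 ^ j))"
    and int2: "(\<integral>\<^sup>+ x \<in> {1<..}. ennreal (- ln (L x) / (x * (ln x)\<^sup>2)) \<partial>lborel) < \<infinity>"
  shows "\<exists>c C. 0 < c \<and> c < C \<and> (\<forall>\<epsilon>>0. \<exists>N. \<forall>x::int ^ 'd. norm1 x \<ge> N \<longrightarrow>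
    prob {s \<in> space M. c \<le> passage_time L \<omega> s 0 x / ln (norm1 x) \<and> passage_time L \<omega> s 0 x / ln (norm1 x) \<le> C} \<ge> 1 - \<epsilon>)"
proof -
  obtain \<theta> K where th: "0 < \<theta>" "0 < K" and lower: "\<And>x t. x \<noteq> 0 \<Longrightarrow>
      prob {s \<in> space M. dist_in L UNIV (\<lambda>e. \<omega> e s) 0 x < t} \<le> K * exp (\<theta> * t) / norm1 x"
    using dist_in_lower_tail[OF sL] by blast
  obtain C where C: "0 < C" and upper: "\<And>x j. norm1 x < 2 ^ j \<Longrightarrow>
      prob {s \<in> space M. C * (real j + 1) < dist_in L UNIV (\<lambda>e. \<omega> e s) 0 x} \<le> exp (- (real j + 1))"
    using dist_in_upper_tail[OF int2] by blast
  \<comment> \<open>Chosen so that exp(\<theta> c ln n) = sqrt n, which turns the lower tail bound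
    into K / sqrt n.\<close>
  define c where "c = 1 / (2 * \<theta>)"
  have c: "0 < c" using th by (simp add: c_def)
  \<comment> \<open>The 4 comes from j + 1 <= 4 ln n for the dyadic scale j just above n; adding c
    forces c < C'.\<close>
  define C' where "C' = 4 * C + c"
  have "\<exists>N. \<forall>x::int ^ 'd. norm1 x \<ge> N \<longrightarrow>
    prob {s \<in> space M. c \<le> passage_time L \<omega> s 0 x / ln (norm1 x) \<and> passage_time L \<omega> s 0 x / ln (norm1 x) \<le> C'} \<ge> 1 - \<epsilon>"
    if eps: "0 < \<epsilon>" for \<epsilon>
  \<comment> \<open>Beyond 3 > e the logarithm is at least 1. The square makes (K + 1) / sqrt n, the
    sum of the two tail bounds, at most \<epsilon>.\<close>
  proof (intro exI[of _ "max 3 (((K + 1) / \<epsilon>)\<^sup>2)"] allI impI)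
    fix x :: "int ^ 'd" assume x: "max 3 (((K + 1) / \<epsilon>)\<^sup>2) \<le> norm1 x"
    define n where "n = norm1 x"
    have n3: "3 \<le> n" and neps: "((K + 1) / \<epsilon>)\<^sup>2 \<le> n" using x by (auto simp: n_def)
    have x0: "x \<noteq> 0" using n3 by (auto simp: n_def)
    have ln1: "1 \<le> ln n" using n3 exp_le by (subst ln_ge_iff) auto
    obtain m where m: "2 ^ m \<le> n" "n < 2 ^ (m + 1)"
    proof -
      obtain k where k: "n = real k" using norm1_eq_of_nat[of x] by (auto simp: n_def)
      then obtain m where "2 ^ m \<le> k" "k < 2 ^ (m + 1)" using ex_power_ivl1[of 2 k] n3 by auto
      then have "real (2 ^ m) \<le> n" "n < real (2 ^ (m + 1))" unfolding k by (simp_all only: of_nat_le_iff of_nat_less_iff)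
      then show ?thesis using that by simp
    qed
    define j where "j = m + 1"
    have j: "real j + 1 \<le> 4 * ln n"
    proof -
      have "real m * ln 2 = ln (2 ^ m)" by (rule ln_realpow[symmetric])
      also have "\<dots> \<le> ln n" using m n3 by (subst ln_le_cancel_iff) auto
      finally have "real m * ln 2 \<le> ln n" .
      moreover have "real m * (1/2) \<le> real m * ln 2" using ln2_ge_two_thirds by (intro mult_left_mono) auto
      ultimately show ?thesis using ln1 by (simp add: j_def)
    qed
    have expj: "exp (- (real j + 1)) \<le> 1 / sqrt n"
    proof -
      have "sqrt n \<le> n" using n3 by (simp add: real_sqrt_le_iff' sqrt_le_D real_le_lsqrt power2_eq_square)
      also have "n \<le> 2 ^ j" using m by (simp add: j_def)
      also have "\<dots> \<le> exp 1 ^ j" using exp_ge_add_one_self[of 1] by (intro power_mono) auto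
      also have "\<dots> = exp (real j)" by (simp add: exp_of_nat_mult[symmetric])
      also have "\<dots> \<le> exp (real j + 1)" by simp
      finally have "1 / exp (real j + 1) \<le> 1 / sqrt n" using n3 by (intro divide_left_mono) auto
      then show ?thesis by (simp only: exp_minus inverse_eq_divide)
    qed
    let ?D = "\<lambda>s. dist_in L UNIV (\<lambda>e. \<omega> e s) 0 x"
    let ?B1 = "{s \<in> space M. ?D s < c * ln n}" and ?B2 = "{s \<in> space M. C * (real j + 1) < ?D s}"
    have "exp (\<theta> * (c * ln n)) = sqrt n"
    proof -
      have "\<theta> * (c * ln n) = ln (sqrt n)" using th n3 by (simp add: c_def ln_sqrt)
      then show ?thesis using n3 by simp
    qed
    then have "prob ?B1 \<le> K * sqrt n / n" using lower[OF x0, of "c * ln n"] by (simp add: n_def)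
    also have "K * sqrt n / n = K / sqrt n"
      using n3 by (simp add: divide_simps)
    finally have "prob ?B1 + prob ?B2 \<le> (K + 1) / sqrt n"
      using upper[of x j] m(2) expj by (simp add: n_def j_def add_divide_distrib)
    also have "\<dots> \<le> \<epsilon>"
    proof -
      have "(K + 1) / \<epsilon> \<le> sqrt n" using neps by (rule real_le_rsqrt)
      then show ?thesis using eps n3 by (simp add: field_simps)
    qed
    finally have "prob ?B1 + prob ?B2 \<le> \<epsilon>" .
    moreover have "prob (?B1 \<union> ?B2) \<le> prob ?B1 + prob ?B2"
      by (rule measure_Un_le) measurable
    ultimately have bad: "prob (?B1 \<union> ?B2) \<le> \<epsilon>" by linarith
    let ?A = "{s \<in> space M. c \<le> passage_time L \<omega> s 0 x / ln (norm1 x) \<and> passage_time L \<omega> s 0 x / ln (norm1 x) \<le> C'}"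
    have [measurable]: "(\<lambda>s. passage_time L \<omega> s 0 x) \<in> borel_measurable M"
      by (intro passage_time_measurable omega_measurable)
    have "1 - \<epsilon> \<le> 1 - prob (?B1 \<union> ?B2)" using bad by simp
    also have "\<dots> = prob (space M - (?B1 \<union> ?B2))" by (rule prob_compl[symmetric]) measurable
    also have "\<dots> \<le> prob ?A"
    proof (rule finite_measure_mono_AE)
      show "AE s in M. s \<in> space M - (?B1 \<union> ?B2) \<longrightarrow> s \<in> ?A"
        using AE_passage_time_eq[of 0 x]
      proof eventually_elim
        case (elim s)
        show ?case
        proof
          assume s: "s \<in> space M - (?B1 \<union> ?B2)"
          then have "c * ln n \<le> ?D s" "?D s \<le> C * (real j + 1)" by auto
          moreover have "C * (real j + 1) \<le> C' * ln n"
          proof -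
            have "C * (real j + 1) \<le> C * (4 * ln n)" using j C by (intro mult_left_mono) auto
            also have "\<dots> \<le> C' * ln n" using c ln1 by (simp add: C'_def distrib_right)
            finally show ?thesis .
          qed
          ultimately show "s \<in> ?A" using s elim ln1 by (simp add: n_def le_divide_eq divide_le_eq)
        qed
      qed
      show "?A \<in> events" by measurable
    qed
    finally show "1 - \<epsilon> \<le> prob ?A" .
  qed
  moreover have "c < C'" using C by (simp add: C'_def)
  ultimately show ?thesis using c by blast
qed

lemma expected_ball_ge:
  assumes "finite F"
  shows "ennreal (\<Sum>x\<in>F. prob {s \<in> space M. dist_in L UNIV (\<lambda>e. \<omega> e s) 0 x \<le> t})
    \<le> (\<integral>\<^sup>+ s. emeasure (count_space UNIV) (fpp_ball L \<omega> s t) \<partial>M)"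
proof -
  let ?D = "\<lambda>x s. dist_in L UNIV (\<lambda>e. \<omega> e s) 0 x"
  have "ennreal (\<Sum>x\<in>F. prob {s \<in> space M. ?D x s \<le> t}) = (\<Sum>x\<in>F. emeasure M {s \<in> space M. ?D x s \<le> t})"
    by (simp add: sum_ennreal emeasure_eq_measure)
  also have "\<dots> = (\<Sum>x\<in>F. \<integral>\<^sup>+ s. indicator {s \<in> space M. ?D x s \<le> t} s \<partial>M)"
    by (intro sum.cong refl nn_integral_indicator[symmetric]) measurable
  also have "\<dots> = (\<integral>\<^sup>+ s. (\<Sum>x\<in>F. indicator {s \<in> space M. ?D x s \<le> t} s) \<partial>M)"
    by (intro nn_integral_sum[symmetric]) measurable
  also have "\<dots> \<le> (\<integral>\<^sup>+ s. emeasure (count_space UNIV) (fpp_ball L \<omega> s t) \<partial>M)"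
  proof (rule nn_integral_mono_AE)
    show "AE s in M. (\<Sum>x\<in>F. indicator {s \<in> space M. ?D x s \<le> t} s) \<le> emeasure (count_space UNIV) (fpp_ball L \<omega> s t)"
      using AE_omega_nonneg
    proof eventually_elim
      case (elim s)
      have "(\<Sum>x\<in>F. indicator {s \<in> space M. ?D x s \<le> t} s) \<le> (\<Sum>x\<in>F. indicator (fpp_ball L \<omega> s t) x :: ennreal)"
        using elim passage_time_eq_dist_in[of \<omega> s L 0]
        by (intro sum_mono) (auto simp: indicator_def fpp_ball_def)
      also have "\<dots> = (\<Sum>x\<in>F \<inter> fpp_ball L \<omega> s t. 1)"
        using assms by (intro sum.mono_neutral_cong_right) (auto simp: indicator_def)
      also have "\<dots> = emeasure (count_space UNIV) (F \<inter> fpp_ball L \<omega> s t)"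
        using assms by simp
      also have "\<dots> \<le> emeasure (count_space UNIV) (fpp_ball L \<omega> s t)"
        by (intro emeasure_mono) auto
      finally show ?case .
    qed
  qed
  finally show ?thesis .
qed

lemma expected_ball_ge_large_t:
  assumes int2: "(\<integral>\<^sup>+ x \<in> {1<..}. ennreal (- ln (L x) / (x * (ln x)\<^sup>2)) \<partial>lborel) < \<infinity>"
  shows "\<exists>a>0. \<exists>t0>0. \<forall>t\<ge>t0. ennreal (exp (a * t)) \<le> (\<integral>\<^sup>+ s. emeasure (count_space UNIV) (fpp_ball L \<omega> s t) \<partial>M)"
proof -
  obtain C where C: "0 < C" and upper: "\<And>x j. norm1 x < 2 ^ j \<Longrightarrow>
      prob {s \<in> space M. C * (real j + 1) < dist_in L UNIV (\<lambda>e. \<omega> e s) 0 x} \<le> exp (- (real j + 1))"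
    using dist_in_upper_tail[OF int2] by blast
  \<comment> \<open>The dimension pays for the diameter of the box. The 10 makes v >= 20, so that
    v/4 + 1 <= 2/3 j, where j > v/2 - 1 and 2/3 < ln 2.\<close>
  define b where "b = real CARD('d) + 10"
  have b: "0 < b" by (simp add: b_def)
  have "ennreal (exp (1 / (4 * C) * t)) \<le> (\<integral>\<^sup>+ s. emeasure (count_space UNIV) (fpp_ball L \<omega> s t) \<partial>M)"
    if t: "2 * C * b \<le> t" for t
  proof -
    define v where "v = t / C"
    have v: "2 * b \<le> v" "t = C * v" using t C by (auto simp: v_def field_simps)
    define j where "j = nat \<lfloor>v - b\<rfloor>"
    have j: "real j \<le> v - b" "v - b < real j + 1" using v b unfolding j_def by linarith+
    let ?F = "dyadic_box (0 :: int ^ 'd) j 0"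
    let ?P = "\<lambda>x. prob {s \<in> space M. dist_in L UNIV (\<lambda>e. \<omega> e s) 0 x \<le> t}"
    have half: "1/2 \<le> ?P x" if x: "x \<in> ?F" for x
    proof -
      \<comment> \<open>The extra 1 turns the diameter bound into the strict inequality that the
        tail estimate requires.\<close>
      let ?j = "j + CARD('d) + 1"
      have "norm1 (x - 0) \<le> 2 ^ (j + CARD('d))" using x by (intro norm1_le_in_dyadic_box) auto
      also have "\<dots> < 2 ^ ?j" by (intro power_strict_increasing) auto
      finally have nx: "norm1 x < 2 ^ ?j" by simp
      have "C * (real ?j + 1) \<le> t" using j(1) C unfolding v(2) b_def by (intro mult_left_mono) auto
      then have "prob (space M - {s \<in> space M. dist_in L UNIV (\<lambda>e. \<omega> e s) 0 x \<le> t})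
          \<le> prob {s \<in> space M. C * (real ?j + 1) < dist_in L UNIV (\<lambda>e. \<omega> e s) 0 x}"
        by (intro finite_measure_mono) (auto, measurable)
      also have "\<dots> \<le> exp (- (real ?j + 1))" by (rule upper[OF nx])
      also have "\<dots> \<le> exp (- 1)" by simp
      also have "\<dots> \<le> 1/2" using exp_ge_add_one_self[of 1] by (simp add: exp_minus inverse_eq_divide divide_le_eq)
      finally show ?thesis by (subst (asm) prob_compl) auto
    qed
    have "exp (1 / (4 * C) * t) = exp (v / 4)" using C by (simp add: v_def)
    also have "\<dots> \<le> exp (real j * (2/3)) / 2"
    proof -
      have "v / 4 + 1 \<le> real j * (2/3)" using j(2) v(1) by (simp add: b_def)
      have "2 * exp (v / 4) \<le> exp 1 * exp (v / 4)"
        using exp_ge_add_one_self[of 1] by (intro mult_right_mono) auto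
      also have "\<dots> = exp (v / 4 + 1)" by (simp add: exp_add)
      also have "\<dots> \<le> exp (real j * (2/3))" using \<open>v / 4 + 1 \<le> real j * (2/3)\<close> by simp
      finally show ?thesis by simp
    qed
    also have "\<dots> \<le> 2 ^ j * (1/2)"
    proof -
      have "real j * (2/3) \<le> real j * ln 2" using ln2_ge_two_thirds by (intro mult_left_mono) auto
      then have "exp (real j * (2/3)) \<le> exp (real j * ln 2)" by simp
      also have "\<dots> = 2 ^ j" by (simp add: exp_of_nat_mult)
      finally show ?thesis by simp
    qed
    also have "\<dots> \<le> real (card ?F) * (1/2)"
      unfolding card_dyadic_box by (simp add: power_increasing)
    also have "\<dots> = (\<Sum>x\<in>?F. 1/2)" by simp
    also have "\<dots> \<le> (\<Sum>x\<in>?F. ?P x)" by (intro sum_mono half)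
    finally have "ennreal (exp (1 / (4 * C) * t)) \<le> ennreal (\<Sum>x\<in>?F. ?P x)" by (rule ennreal_leI)
    also have "\<dots> \<le> (\<integral>\<^sup>+ s. emeasure (count_space UNIV) (fpp_ball L \<omega> s t) \<partial>M)"
      by (rule expected_ball_ge[OF finite_dyadic_box])
    finally show ?thesis .
  qed
  moreover have "0 < 1 / (4 * C)" "0 < 2 * C * b" using C b by auto
  ultimately show ?thesis by blast
qed

text \<open>The origin counts 1; a unit neighbour is reached along an edge of rate L(1) = 1, hence
  by time t with probability at least 1 - exp(-t). The bound equals 1 at t = 0 and has positive
  slope there.\<close>

lemma expected_ball_ge_small_t:
  assumes L1: "L 1 = 1" and t: "0 \<le> t"
  shows "ennreal (2 - exp (- t)) \<le> (\<integral>\<^sup>+ s. emeasure (count_space UNIV) (fpp_ball L \<omega> s t) \<partial>M)"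
proof -
  define k :: 'd where "k = undefined"
  define u :: "int ^ 'd" where "u = (\<chi> i. if i = k then 1 else 0)"
  have "norm1 u = (\<Sum>i\<in>UNIV. if i = k then 1 else 0)" unfolding norm1_def u_def by (intro sum.cong) auto
  then have nu: "norm1 u = 1" by simp
  then have u0: "u \<noteq> 0" by auto
  have nu': "norm1 (0 - u) = 1" using nu norm1_minus_commute[of 0 u] by simp
  let ?P = "\<lambda>x. prob {s \<in> space M. dist_in L UNIV (\<lambda>e. \<omega> e s) 0 x \<le> t}"
  have "?P 0 = 1" using t by (simp add: dist_in_refl SV prob_space)
  moreover have "1 - exp (- t) \<le> ?P u"
  proof -
    have e: "{0, u} \<in> edges" using u0 by (intro edge_in_edges) auto
    have "1 - exp (- t) = prob {s \<in> space M. \<omega> {0, u} s \<le> t}"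
      using exponential_distributedD_le[OF expo[OF e] t] by simp
    also have "\<dots> \<le> ?P u"
    proof (rule finite_measure_mono)
      show "{s \<in> space M. \<omega> {0, u} s \<le> t} \<subseteq> {s \<in> space M. dist_in L UNIV (\<lambda>e. \<omega> e s) 0 u \<le> t}"
      proof safe
        fix s assume s: "\<omega> {0, u} s \<le> t"
        have "dist_in L UNIV (\<lambda>e. \<omega> e s) 0 u \<le> cost L (\<lambda>e. \<omega> e s) 0 u"
          using u0 by (intro dist_in_le_cost SV) auto
        also have "\<dots> \<le> t" unfolding cost_def nu' using s t L1 by (simp add: rate_def)
        finally show "dist_in L UNIV (\<lambda>e. \<omega> e s) 0 u \<le> t" .
      qed
    qed measurable
    finally show ?thesis .
  qed
  ultimately have "ennreal (2 - exp (- t)) \<le> ennreal (\<Sum>x\<in>{0, u}. ?P x)"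
    using u0 by (intro ennreal_leI) simp
  also have "\<dots> \<le> (\<integral>\<^sup>+ s. emeasure (count_space UNIV) (fpp_ball L \<omega> s t) \<partial>M)"
    by (rule expected_ball_ge) simp
  finally show ?thesis .
qed

lemma expected_ball_exponential_growth:
  assumes L1: "L 1 = 1"
    and int2: "(\<integral>\<^sup>+ x \<in> {1<..}. ennreal (- ln (L x) / (x * (ln x)\<^sup>2)) \<partial>lborel) < \<infinity>"
  shows "\<exists>a>0. \<forall>t\<ge>0. (\<integral>\<^sup>+ s. emeasure (count_space UNIV) (fpp_ball L \<omega> s t) \<partial>M) \<ge> ennreal (exp (a * t))"
proof -
  obtain a1 t0 where a1: "0 < a1" "0 < t0" and large: "\<And>t. t0 \<le> t \<Longrightarrow>
      ennreal (exp (a1 * t)) \<le> (\<integral>\<^sup>+ s. emeasure (count_space UNIV) (fpp_ball L \<omega> s t) \<partial>M)"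
    using expected_ball_ge_large_t[OF int2] by blast
  \<comment> \<open>a <= 1/t0 gives a t <= 1 below t0, so exp(a t) <= 1 + 2 a t; and 2 a <= exp(-t0)
    turns this into 1 + t exp(-t), which is at most 2 - exp(-t) because 1 + t <= exp t.\<close>
  define a where "a = min a1 (min (exp (- t0) / 2) (1 / t0))"
  have a: "0 < a" "a \<le> a1" "2 * a \<le> exp (- t0)" "a \<le> 1 / t0" using a1 by (auto simp: a_def)
  have "ennreal (exp (a * t)) \<le> (\<integral>\<^sup>+ s. emeasure (count_space UNIV) (fpp_ball L \<omega> s t) \<partial>M)" if t: "0 \<le> t" for t
  proof (cases "t0 \<le> t")
    case True
    have "ennreal (exp (a * t)) \<le> ennreal (exp (a1 * t))"
      using a(2) t by (intro ennreal_leI) (simp add: mult_right_mono)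
    also note large[OF True]
    finally show ?thesis .
  next
    case False
    have "a * t \<le> 1 / t0 * t0" using a(1,4) False t by (intro mult_mono) auto
    then have at: "0 \<le> a * t" "a * t \<le> 1" using a a1 t by auto
    have "exp (a * t) \<le> 1 + a * t + (a * t)\<^sup>2" using at by (rule exp_bound)
    also have "\<dots> \<le> 1 + (2 * a) * t"
      using mult_left_mono[OF at(2,1)] by (simp add: power2_eq_square)
    also have "\<dots> \<le> 1 + exp (- t) * t"
    proof -
      have "exp (- t0) \<le> exp (- t)" using False by simp
      then show ?thesis using a(3) t by (intro add_left_mono mult_right_mono) linarith+
    qed
    also have "\<dots> \<le> 2 - exp (- t)"
    proof -
      have "exp (- t) * (1 + t) \<le> exp (- t) * exp t" by (intro mult_left_mono) auto
      also have "\<dots> = 1" by (simp add: exp_add[symmetric])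
      finally show ?thesis by (simp add: algebra_simps)
    qed
    finally have "ennreal (exp (a * t)) \<le> ennreal (2 - exp (- t))" by (rule ennreal_leI)
    also note expected_ball_ge_small_t[OF L1 t]
    finally show ?thesis .
  qed
  then show ?thesis using a(1) by blast
qed

end

theorem theorem1p2:
  fixes M :: "'a measure"
    and \<omega> :: "(int ^ 'd) set \<Rightarrow> 'a \<Rightarrow> real"
    and L :: "real \<Rightarrow> real"
  assumes "prob_space M"
    and iid_indep: "prob_space.indep_vars M (\<lambda>_. borel) \<omega> edges"
    and iid_exp: "\<And>e. e \<in> edges \<Longrightarrow> distributed M lborel (\<omega> e) (exponential_density 1)"
    and SV: "slowly_varying L"
    and L1: "L 1 = 1"
    and r_nonneg: "\<And>k::nat. k \<ge> 1 \<Longrightarrow> rate CARD('d) L (real k) \<ge> 0"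
    and r_noninc: "\<And>k m::nat. 1 \<le> k \<Longrightarrow> k \<le> m \<Longrightarrow> rate CARD('d) L (real m) \<le> rate CARD('d) L (real k)"
    and int1: "(\<integral>\<^sup>+ x \<in> {1..}. ennreal (L x / x) \<partial>lborel) < \<infinity>"
    and int2: "(\<integral>\<^sup>+ x \<in> {1<..}. ennreal (- ln (L x) / (x * (ln x)\<^sup>2)) \<partial>lborel) < \<infinity>"
  shows "(\<exists>c C. 0 < c \<and> c < C \<and>
            (\<forall>\<epsilon>>0. \<exists>N. \<forall>x::int ^ 'd. norm1 x \<ge> N \<longrightarrow>
               measure M {s \<in> space M. c \<le> passage_time L \<omega> s 0 x / ln (norm1 x)
                                      \<and> passage_time L \<omega> s 0 x / ln (norm1 x) \<le> C} \<ge> 1 - \<epsilon>))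
       \<and> (\<exists>a>0. \<forall>t\<ge>0. (\<integral>\<^sup>+ s. emeasure (count_space UNIV) (fpp_ball L \<omega> s t) \<partial>M)
                          \<ge> ennreal (exp (a * t)))"
proof -
  interpret prob_space M by fact
  interpret long_range_fpp M \<omega> L
    using iid_indep iid_exp SV r_noninc by unfold_locales
  show ?thesis
    using passage_time_logarithmic[OF summable_L_dyadic[OF SV int1] int2]
      expected_ball_exponential_growth[OF L1 int2] by (rule conjI)
qed

end
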